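(* Let $I:W_n\to W_{n+1}$ be either $F_n:W(\tilde C_n)\to W(\tilde C_{n+1})$ (with $n\ge 2$) or $L_n:W(\tilde B_n)\to W(\tilde B_{n+1})$ (with $n\ge 3$), as defined in the context. Let $w\in W_n$, fix a reduced expression $$w=u_0\,t_n\,u_1\cdots u_{s-1}\,t_n\,u_s$$ where $u_0,\dots,u_s$ are reduced words in the generators of $W_n$ other than $t_n$, and consider the word $$u_0\,\sigma_nt_{n+1}\sigma_n\,u_1\cdots u_{s-1}\,\sigma_nt_{n+1}\sigma_n\,u_s$$ representing $I(w)$ in $W_{n+1}$. Let $\Phi(I(w))$ be the multiset $\Phi$ attached to this word. Then $$\operatorname{MCard}\Phi(I(w))=\operatorname{Card}\Phi(I(w))=l(w)+2L(w).$$ In particular, substituting $\sigma_nt_{n+1}\sigma_n$ for $t_n$ in a reduced expression of $w$ produces a reduced expression of $I(w)$.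
   Context: For $m\ge 2$, $W(\tilde C_m)$ is the Coxeter group with generators $\sigma_0,\sigma_1,\dots,\sigma_{m-1},t_m$, where $\sigma_0\sigma_1$ has order 4, $\sigma_i\sigma_{i+1}$ has order 3 for $1\le i\le m-2$, $\sigma_{m-1}t_m$ has order 4, and all other pairs of distinct generators commute. For $m\ge 3$, $W(\tilde B_m)$ is the Coxeter group with generators $\sigma_1,\sigma_{\bar 1},\sigma_2,\dots,\sigma_{m-1},t_m$, where $\sigma_i\sigma_{i+1}$ has order 3 for $1\le i\le m-2$, $\sigma_{\bar 1}\sigma_2$ has order 3, $\sigma_{m-1}t_m$ has order 4, and all other pairs of distinct generators commute. $F_n:W(\tilde C_n)\to W(\tilde C_{n+1})$ and $L_n:W(\tilde B_n)\to W(\tilde B_{n+1})$ are the (injective) group homomorphisms that send every generator other than $t_n$ to the generator with the same name and send $t_n$ to $\sigma_n t_{n+1}\sigma_n$. $l$ denotes Coxeter length. For $w\in W(\tilde B_m)$ or $W(\tilde C_m)$, the affine length $L(w)$ is the number of occurrences of $t_m$ in a reduced expression of $w$; it does not depend on the reduced expression. For a Coxeter system $(W,S)$ and a finite sequence $\mathbf s=(s_1,\dots,s_r)$ of elements of $S$, $\Phi(\mathbf s)$ is the multiset $\{\{h_1,\dots,h_r\}\}$ of elements of $W$ with $h_j=(s_1\cdots s_{j-1})\,s_j\,(s_1\cdots s_{j-1})^{-1}$. $\operatorname{MCard}\Phi(\mathbf s)$ is the number of elements counted with multiplicity (namely $r$) and $\operatorname{Card}\Phi(\mathbf s)$ is the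 cardinality of the underlying set. *)

theory Defs
  imports "HOL-Algebra.Group" "HOL-Library.Multiset"
begin

section \<open>Coxeter systems given by a Coxeter matrix\<close>

text \<open>
  The entry \<open>cmat A s t\<close> is the order of \<open>s t\<close> in the Coxeter group, with
  \<open>0\<close> for infinite order. Entries outside \<open>gens A\<close> are irrelevant.
\<close>

record 's coxeter_datum =
  gens :: "'s set"
  cmat :: "'s \<Rightarrow> 's \<Rightarrow> nat"

text \<open>
  The congruence on words generated by \<open>(s t)\<^sup>m = 1\<close> with \<open>m = cmat A s t\<close>. Since the diagonal entries
  are \<open>1\<close>, each letter is its own inverse, so the quotient of the free monoid on \<open>gens A\<close>
  is the group with this presentation.
\<close>

inductive cox_eq :: "'s coxeter_datum \<Rightarrow> 's list \<Rightarrow> 's list \<Rightarrow> bool" for A where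
  refl: "w \<in> lists (gens A) \<Longrightarrow> cox_eq A w w"
| sym: "cox_eq A v w \<Longrightarrow> cox_eq A w v"
| trans: "cox_eq A u v \<Longrightarrow> cox_eq A v w \<Longrightarrow> cox_eq A u w"
| relator: "s \<in> gens A \<Longrightarrow> t \<in> gens A \<Longrightarrow> u \<in> lists (gens A) \<Longrightarrow> v \<in> lists (gens A) \<Longrightarrow>
    cox_eq A (u @ concat (replicate (cmat A s t) [s, t]) @ v) (u @ v)"

definition cox_class :: "'s coxeter_datum \<Rightarrow> 's list \<Rightarrow> 's list set" where
  "cox_class A u = {v. cox_eq A u v}"

definition cox_group :: "'s coxeter_datum \<Rightarrow> 's list set monoid" where
  "cox_group A =
    \<lparr>carrier = cox_class A ` lists (gens A),
     monoid.mult = (\<lambda>X Y. \<Union>u\<in>X. \<Union>v\<in>Y. cox_class A (u @ v)),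
     one = cox_class A []\<rparr>"

definition cox_gen :: "'s coxeter_datum \<Rightarrow> 's \<Rightarrow> 's list set" where
  "cox_gen A s = cox_class A [s]"

definition list_prod :: "('a, 'b) monoid_scheme \<Rightarrow> 'a list \<Rightarrow> 'a" where
  "list_prod G xs = foldr (monoid.mult G) xs (one G)"

definition word_val :: "'s coxeter_datum \<Rightarrow> 's list \<Rightarrow> 's list set" where
  "word_val A e = list_prod (cox_group A) (map (cox_gen A) e)"

definition cox_length :: "'s coxeter_datum \<Rightarrow> 's list set \<Rightarrow> nat" where
  "cox_length A w = (LEAST r. \<exists>e \<in> lists (gens A). word_val A e = w \<and> length e = r)"

definition reduced_expr :: "'s coxeter_datum \<Rightarrow> 's list \<Rightarrow> 's list set \<Rightarrow> bool" where
  "reduced_expr A e w \<longleftrightarrow>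
     e \<in> lists (gens A) \<and> word_val A e = w \<and> length e = cox_length A w"

definition reduced_word :: "'s coxeter_datum \<Rightarrow> 's list \<Rightarrow> bool" where
  "reduced_word A e \<longleftrightarrow> reduced_expr A e (word_val A e)"

text \<open>
  Number of occurrences of the letter \<open>t\<close> in a reduced expression of \<open>w\<close>. When, as for the
  generator \<open>t\<^sub>m\<close> below, this does not depend on the reduced expression, the choice is immaterial.
\<close>

definition letter_length :: "'s coxeter_datum \<Rightarrow> 's \<Rightarrow> 's list set \<Rightarrow> nat" where
  "letter_length A t w = count_list (SOME e. reduced_expr A e w) t"

text \<open>The list index \<open>j\<close> starts at \<open>0\<close>, so \<open>take j xs\<close> consists of the letters preceding \<open>xs ! j\<close>.\<close>

definition Phi :: "('a, 'b) monoid_scheme \<Rightarrow> 'a list \<Rightarrow> 'a multiset" where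
  "Phi G xs = mset (map (\<lambda>j.
      list_prod G (take j xs) \<otimes>\<^bsub>G\<^esub> (xs ! j) \<otimes>\<^bsub>G\<^esub> inv\<^bsub>G\<^esub> (list_prod G (take j xs)))
    [0..<length xs])"

definition word_Phi :: "'s coxeter_datum \<Rightarrow> 's list \<Rightarrow> 's list set multiset" where
  "word_Phi A e = Phi (cox_group A) (map (cox_gen A) e)"


section \<open>The affine types and the two towers\<close>

text \<open>\<open>SigBar\<close> is the generator \<open>\<sigma>\<close> with index one-bar; \<open>T m\<close> is \<open>t\<^sub>m\<close>.\<close>

datatype gen = Sig nat | SigBar | T nat

definition C_tilde :: "nat \<Rightarrow> gen coxeter_datum" where
  "C_tilde m =
    \<lparr>gens = Sig ` {0..<m} \<union> {T m},
     cmat = (\<lambda>s t.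
       if s = t then 1
       else if {s, t} = {Sig 0, Sig 1} then 4
       else if {s, t} = {Sig (m - 1), T m} then 4
       else if \<exists>i. 1 \<le> i \<and> i \<le> m - 2 \<and> {s, t} = {Sig i, Sig (i + 1)} then 3
       else 2)\<rparr>"

definition B_tilde :: "nat \<Rightarrow> gen coxeter_datum" where
  "B_tilde m =
    \<lparr>gens = Sig ` {1..<m} \<union> {SigBar, T m},
     cmat = (\<lambda>s t.
       if s = t then 1
       else if {s, t} = {SigBar, Sig 2} then 3
       else if {s, t} = {Sig (m - 1), T m} then 4
       else if \<exists>i. 1 \<le> i \<and> i \<le> m - 2 \<and> {s, t} = {Sig i, Sig (i + 1)} then 3
       else 2)\<rparr>"

definition subst_letter :: "nat \<Rightarrow> gen \<Rightarrow> gen list" where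
  "subst_letter n s = (if s = T n then [Sig n, T (n + 1), Sig n] else [s])"

definition subst_word :: "nat \<Rightarrow> gen list \<Rightarrow> gen list" where
  "subst_word n e = concat (map (subst_letter n) e)"

definition is_tower_hom ::
  "nat \<Rightarrow> gen coxeter_datum \<Rightarrow> gen coxeter_datum \<Rightarrow> (gen list set \<Rightarrow> gen list set) \<Rightarrow> bool" where
  "is_tower_hom n A A' f \<longleftrightarrow>
     f \<in> hom (cox_group A) (cox_group A') \<and> f \<in> extensional (carrier (cox_group A)) \<and>
     (\<forall>s \<in> gens A - {T n}. f (cox_gen A s) = cox_gen A' s) \<and>
     f (cox_gen A (T n)) =
       cox_gen A' (Sig n) \<otimes>\<^bsub>cox_group A'\<^esub> cox_gen A' (T (n + 1)) \<otimes>\<^bsub>cox_group A'\<^esub> cox_gen A' (Sig n)"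

text \<open>Existence and uniqueness are proved at the end of this theory.\<close>

definition F_hom :: "nat \<Rightarrow> gen list set \<Rightarrow> gen list set" where
  "F_hom n = (THE f. is_tower_hom n (C_tilde n) (C_tilde (n + 1)) f)"

definition L_hom :: "nat \<Rightarrow> gen list set \<Rightarrow> gen list set" where
  "L_hom n = (THE f. is_tower_hom n (B_tilde n) (B_tilde (n + 1)) f)"

text \<open>The word \<open>u\<^sub>0 x u\<^sub>1 x \<dots> x u\<^sub>s\<close>.\<close>

definition interleave :: "'s list \<Rightarrow> (nat \<Rightarrow> 's list) \<Rightarrow> nat \<Rightarrow> 's list" where
  "interleave x u s = u 0 @ concat (map (\<lambda>i. x @ u (i + 1)) [0..<s])"


section \<open>Basic facts\<close>

lemma cox_eq_lists: "cox_eq A u v \<Longrightarrow> u \<in> lists (gens A) \<and> v \<in> lists (gens A)"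
proof (induction rule: cox_eq.induct)
  case (relator s t u v)
  have "set (concat (replicate k [s, t])) \<subseteq> gens A" for k
    using relator by (induction k) auto
  with relator show ?case by (auto simp: in_lists_conv_set)
qed auto

lemma cox_eq_append_left:
  "cox_eq A u v \<Longrightarrow> x \<in> lists (gens A) \<Longrightarrow> cox_eq A (x @ u) (x @ v)"
proof (induction rule: cox_eq.induct)
  case (refl w)
  then show ?case by (intro cox_eq.refl) auto
next
  case (relator s t u v)
  then show ?case using cox_eq.relator[of s A t "x @ u" v] by simp
qed (auto intro: cox_eq.intros)

lemma cox_eq_append_right:
  "cox_eq A u v \<Longrightarrow> x \<in> lists (gens A) \<Longrightarrow> cox_eq A (u @ x) (v @ x)"
proof (induction rule: cox_eq.induct)
  case (refl w)
  then show ?case by (intro cox_eq.refl) auto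
next
  case (relator s t u v)
  then show ?case using cox_eq.relator[of s A t u "v @ x"] by simp
qed (auto intro: cox_eq.intros)

lemma cox_class_eq_iff:
  "u \<in> lists (gens A) \<Longrightarrow> cox_class A u = cox_class A v \<longleftrightarrow> cox_eq A u v"
  unfolding cox_class_def by (auto intro: cox_eq.intros)

lemma mult_cox_class:
  assumes "u \<in> lists (gens A)" "v \<in> lists (gens A)"
  shows "cox_class A u \<otimes>\<^bsub>cox_group A\<^esub> cox_class A v = cox_class A (u @ v)"
proof -
  have "cox_class A (u' @ v') = cox_class A (u @ v)" if "cox_eq A u u'" "cox_eq A v v'" for u' v'
  proof -
    have "cox_eq A (u @ v) (u' @ v')"
      using cox_eq_append_right[OF that(1), of v] cox_eq_append_left[OF that(2), of u']
        cox_eq_lists[OF that(1)] assms cox_eq.trans by blast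
    then show ?thesis
      using cox_class_eq_iff[of "u @ v" A "u' @ v'"] assms by simp
  qed
  then have "(\<Union>u'\<in>cox_class A u. \<Union>v'\<in>cox_class A v. cox_class A (u' @ v'))
      = (\<Union>u'\<in>cox_class A u. \<Union>v'\<in>cox_class A v. cox_class A (u @ v))"
    by (intro SUP_cong HOL.refl) (simp add: cox_class_def)
  moreover have "u \<in> cox_class A u" "v \<in> cox_class A v"
    using assms by (auto simp: cox_class_def intro: cox_eq.refl)
  then have "(\<Union>u'\<in>cox_class A u. \<Union>v'\<in>cox_class A v. cox_class A (u @ v)) = cox_class A (u @ v)"
    by blast
  ultimately show ?thesis by (simp add: cox_group_def)
qed

lemma group_cox_group:
  assumes "\<And>s. s \<in> gens A \<Longrightarrow> cmat A s s = 1"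
  shows "group (cox_group A)"
proof (rule groupI)
  let ?G = "cox_group A"
  have c: "carrier ?G = cox_class A ` lists (gens A)" and o: "\<one>\<^bsub>?G\<^esub> = cox_class A []"
    by (simp_all add: cox_group_def)
  show "\<one>\<^bsub>?G\<^esub> \<in> carrier ?G" by (auto simp: c o)
  show "x \<otimes>\<^bsub>?G\<^esub> y \<in> carrier ?G" if xy: "x \<in> carrier ?G" "y \<in> carrier ?G" for x y
  proof -
    obtain u v where "u \<in> lists (gens A)" "x = cox_class A u"
      "v \<in> lists (gens A)" "y = cox_class A v" using xy c by auto
    then show ?thesis unfolding c by (simp add: mult_cox_class)
  qed
  show "x \<otimes>\<^bsub>?G\<^esub> y \<otimes>\<^bsub>?G\<^esub> z = x \<otimes>\<^bsub>?G\<^esub> (y \<otimes>\<^bsub>?G\<^esub> z)"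
    if xyz: "x \<in> carrier ?G" "y \<in> carrier ?G" "z \<in> carrier ?G" for x y z
  proof -
    obtain u v w where "u \<in> lists (gens A)" "x = cox_class A u" "v \<in> lists (gens A)"
      "y = cox_class A v" "w \<in> lists (gens A)" "z = cox_class A w" using xyz c by auto
    then show ?thesis by (simp add: mult_cox_class)
  qed
  show "\<one>\<^bsub>?G\<^esub> \<otimes>\<^bsub>?G\<^esub> x = x" if x: "x \<in> carrier ?G" for x
  proof -
    obtain u where "u \<in> lists (gens A)" "x = cox_class A u" using x c by auto
    then show ?thesis by (simp add: o mult_cox_class)
  qed
  show "\<exists>y\<in>carrier ?G. y \<otimes>\<^bsub>?G\<^esub> x = \<one>\<^bsub>?G\<^esub>" if x: "x \<in> carrier ?G" for x
  proof -
    obtain u where u: "x = cox_class A u" "u \<in> lists (gens A)" using x c by auto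
    have "cox_eq A (rev u @ u) []" using u(2)
    proof (induction u)
      case (Cons s u)
      have "cox_eq A (rev u @ [s, s] @ u) (rev u @ u)"
        using cox_eq.relator[of s A s "rev u" u] Cons assms by (auto simp: in_lists_conv_set)
      with Cons show ?case by (auto intro: cox_eq.trans)
    qed (auto intro: cox_eq.refl)
    moreover have r: "rev u \<in> lists (gens A)" using u(2) by (simp add: in_lists_conv_set)
    ultimately have "cox_class A (rev u) \<otimes>\<^bsub>?G\<^esub> x = \<one>\<^bsub>?G\<^esub>"
      using u cox_class_eq_iff[of "rev u @ u" A "[]"] by (simp add: mult_cox_class o)
    then show ?thesis using r c by (intro bexI[of _ "cox_class A (rev u)"]) auto
  qed
qed

lemma word_val_eq_cox_class:
  "e \<in> lists (gens A) \<Longrightarrow> word_val A e = cox_class A e"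
proof (induction e)
  case (Cons s e)
  then show ?case
    using mult_cox_class[of "[s]" A e]
    by (auto simp: word_val_def list_prod_def cox_gen_def)
qed (simp add: word_val_def list_prod_def cox_group_def)

lemma carrier_cox_group: "carrier (cox_group A) = word_val A ` lists (gens A)"
  unfolding cox_group_def using word_val_eq_cox_class by fastforce

lemma cox_gen_closed: "s \<in> gens A \<Longrightarrow> cox_gen A s \<in> carrier (cox_group A)"
  by (auto simp: cox_group_def cox_gen_def)

context group
begin

lemma list_prod_closed: "set xs \<subseteq> carrier G \<Longrightarrow> list_prod G xs \<in> carrier G"
  by (induction xs) (auto simp: list_prod_def)

lemma list_prod_append:
  "set xs \<subseteq> carrier G \<Longrightarrow> set ys \<subseteq> carrier G \<Longrightarrow>
    list_prod G (xs @ ys) = list_prod G xs \<otimes> list_prod G ys"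
proof (induction xs)
  case Nil
  then show ?case using list_prod_closed by (simp add: list_prod_def)
next
  case (Cons x xs)
  then show ?case
    using list_prod_closed[of xs] list_prod_closed[of ys] by (simp add: list_prod_def m_assoc)
qed

lemma list_prod_replicate:
  assumes fc: "f s \<in> carrier G" "f t \<in> carrier G"
  shows "list_prod G (map f (concat (replicate k [s, t]))) = (f s \<otimes> f t) [^] k"
proof (induction k)
  case (Suc k)
  have "list_prod G (map f (concat (replicate (Suc k) [s, t])))
      = f s \<otimes> (f t \<otimes> (f s \<otimes> f t) [^] k)"
    using Suc by (simp add: list_prod_def)
  also have "\<dots> = (f s \<otimes> f t) [^] Suc k"
    using fc nat_pow_mult[of "f s \<otimes> f t" 1 k] by (simp add: m_assoc)
  finally show ?case .
qed (simp add: list_prod_def)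

end

text \<open>The universal property of the presentation.\<close>

lemma cox_group_universal:
  assumes H: "group H" and f: "\<And>s. s \<in> gens A \<Longrightarrow> f s \<in> carrier H"
    and rel: "\<And>s t. s \<in> gens A \<Longrightarrow> t \<in> gens A \<Longrightarrow>
      (f s \<otimes>\<^bsub>H\<^esub> f t) [^]\<^bsub>H\<^esub> cmat A s t = \<one>\<^bsub>H\<^esub>"
    and A: "\<And>s. s \<in> gens A \<Longrightarrow> cmat A s s = 1"
  shows "\<exists>!h. h \<in> hom (cox_group A) H \<and> h \<in> extensional (carrier (cox_group A)) \<and>
    (\<forall>s\<in>gens A. h (cox_gen A s) = f s)"
proof -
  interpret H: group H by (rule H)
  interpret G: group "cox_group A" by (rule group_cox_group) (rule A)
  define p where "p e = list_prod H (map f e)" for e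
  have p_closed: "p e \<in> carrier H" if "e \<in> lists (gens A)" for e
    unfolding p_def using that f by (intro H.list_prod_closed) auto
  have p_append: "p (u @ v) = p u \<otimes>\<^bsub>H\<^esub> p v"
    if "u \<in> lists (gens A)" "v \<in> lists (gens A)" for u v
    using that f unfolding p_def map_append by (intro H.list_prod_append) auto
  have p_eq: "p u = p v" if "cox_eq A u v" for u v
    using that
  proof (induction rule: cox_eq.induct)
    case (relator s t u v)
    let ?r = "concat (replicate (cmat A s t) [s, t])"
    have "?r \<in> lists (gens A)" using relator by (auto simp: in_lists_conv_set)
    moreover have "p ?r = \<one>\<^bsub>H\<^esub>"
      unfolding p_def using H.list_prod_replicate[of f s t] f rel relator by metis
    ultimately show ?case using relator p_closed by (simp add: p_append)
  qed auto
  define h where "h = restrict (\<lambda>X. p (SOME e. e \<in> X)) (carrier (cox_group A))"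
  have h_class: "h (cox_class A e) = p e" if "e \<in> lists (gens A)" for e
  proof -
    have "e \<in> cox_class A e" using that by (auto simp: cox_class_def intro: cox_eq.refl)
    then have "cox_eq A e (SOME x. x \<in> cox_class A e)"
      by (metis (mono_tags) cox_class_def mem_Collect_eq someI)
    then show ?thesis using that p_eq by (force simp: h_def cox_group_def)
  qed
  have h_hom: "h \<in> hom (cox_group A) H"
  proof (rule homI)
    fix X assume "X \<in> carrier (cox_group A)"
    then obtain u where "u \<in> lists (gens A)" "X = cox_class A u" by (auto simp: cox_group_def)
    then show "h X \<in> carrier H" using h_class p_closed by simp
  next
    fix X Y assume "X \<in> carrier (cox_group A)" "Y \<in> carrier (cox_group A)"
    then obtain u v where "u \<in> lists (gens A)" "X = cox_class A u"
      "v \<in> lists (gens A)" "Y = cox_class A v" by (auto simp: cox_group_def)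
    then show "h (X \<otimes>\<^bsub>cox_group A\<^esub> Y) = h X \<otimes>\<^bsub>H\<^esub> h Y"
      using h_class[of u] h_class[of v] h_class[of "u @ v"] p_append[of u v]
      by (simp add: mult_cox_class)
  qed
  have h_gen: "h (cox_gen A s) = f s" if "s \<in> gens A" for s
    using h_class[of "[s]"] that f by (simp add: cox_gen_def p_def list_prod_def)
  show ?thesis
  proof (rule ex1I[of _ h])
    show "h \<in> hom (cox_group A) H \<and> h \<in> extensional (carrier (cox_group A)) \<and>
      (\<forall>s\<in>gens A. h (cox_gen A s) = f s)"
      using h_hom h_gen by (simp add: h_def)
  next
    fix k assume k: "k \<in> hom (cox_group A) H \<and> k \<in> extensional (carrier (cox_group A)) \<and>
      (\<forall>s\<in>gens A. k (cox_gen A s) = f s)"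
    have "k (word_val A e) = p e" if "e \<in> lists (gens A)" for e
      using that
    proof (induction e)
      case Nil
      then show ?case
        using k hom_one[of k "cox_group A" H] G.is_group H
        by (simp add: word_val_def p_def list_prod_def)
    next
      case (Cons s e)
      then have "word_val A e \<in> carrier (cox_group A)" by (auto simp: carrier_cox_group)
      with Cons show ?case
        using k hom_mult[of k "cox_group A" H "cox_gen A s" "word_val A e"] cox_gen_closed[of s A]
        by (simp add: word_val_def p_def list_prod_def)
    qed
    moreover have "h (word_val A e) = p e" if "e \<in> lists (gens A)" for e
      using that h_class word_val_eq_cox_class by metis
    ultimately have "k X = h X" if "X \<in> carrier (cox_group A)" for X
      using that by (metis carrier_cox_group imageE)
    then show "k = h"
      using k by (intro extensionalityI[of k "carrier (cox_group A)" h]) (auto simp: h_def)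
  qed
qed

lemma cox_gen_relation:
  assumes "\<And>s. s \<in> gens A \<Longrightarrow> cmat A s s = 1" "s \<in> gens A" "t \<in> gens A"
  shows "(cox_gen A s \<otimes>\<^bsub>cox_group A\<^esub> cox_gen A t) [^]\<^bsub>cox_group A\<^esub> cmat A s t = \<one>\<^bsub>cox_group A\<^esub>"
proof -
  interpret group "cox_group A" by (rule group_cox_group) (rule assms(1))
  let ?r = "concat (replicate (cmat A s t) [s, t])"
  have "?r \<in> lists (gens A)" using assms by (auto simp: in_lists_conv_set)
  moreover have "cox_eq A ?r []" using cox_eq.relator[of s A t "[]" "[]"] assms by simp
  ultimately have "word_val A ?r = \<one>\<^bsub>cox_group A\<^esub>"
    using cox_class_eq_iff[of ?r A "[]"] by (simp add: word_val_eq_cox_class cox_group_def)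
  then show ?thesis
    using list_prod_replicate[of "cox_gen A" s t] cox_gen_closed assms
    unfolding word_val_def by metis
qed

context group
begin

lemma involution_cancel:
  "x \<in> carrier G \<Longrightarrow> x \<otimes> x = \<one> \<Longrightarrow> a \<in> carrier G \<Longrightarrow> x \<otimes> (x \<otimes> a) = a"
  by (simp flip: m_assoc)

lemma involutions_commute:
  assumes "x \<in> carrier G" "y \<in> carrier G" "x \<otimes> x = \<one>" "y \<otimes> y = \<one>"
    and "(x \<otimes> y) [^] (2::nat) = \<one>"
  shows "y \<otimes> x = x \<otimes> y"
proof -
  have "inv (x \<otimes> y) = x \<otimes> y"
    using assms by (intro inv_equality) (auto simp: numeral_2_eq_2)
  moreover have "inv (x \<otimes> y) = y \<otimes> x"
    using assms by (intro inv_equality) (auto simp: m_assoc involution_cancel)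
  ultimately show ?thesis by simp
qed

lemma involutions_pow_swap:
  assumes "x \<in> carrier G" "y \<in> carrier G" "x \<otimes> x = \<one>" "y \<otimes> y = \<one>"
    and "(x \<otimes> y) [^] (k::nat) = \<one>"
  shows "(y \<otimes> x) [^] k = \<one>"
proof -
  have "inv (x \<otimes> y) = y \<otimes> x"
    using assms by (intro inv_equality) (auto simp: m_assoc involution_cancel)
  then have "(y \<otimes> x) [^] k = inv ((x \<otimes> y) [^] k)"
    using assms nat_pow_inv[of "x \<otimes> y" k] by simp
  then show ?thesis using assms by simp
qed

lemma conj_pow:
  assumes "g \<in> carrier G" "a \<in> carrier G"
  shows "(g \<otimes> a \<otimes> inv g) [^] (k::nat) = g \<otimes> a [^] k \<otimes> inv g"
proof (induction k)
  case (Suc k)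
  have "inv g \<otimes> (g \<otimes> (a \<otimes> inv g)) = a \<otimes> inv g"
    using assms by (simp flip: m_assoc)
  with Suc assms show ?case by (simp add: m_assoc)
qed (use assms in simp)

lemma tower_relations:
  assumes c: "x \<in> carrier G" "y \<in> carrier G" "t \<in> carrier G"
    and sq: "x \<otimes> x = \<one>" "y \<otimes> y = \<one>" "t \<otimes> t = \<one>"
    and xt: "(x \<otimes> t) [^] (2::nat) = \<one>"
  shows "(y \<otimes> t \<otimes> y) \<otimes> (y \<otimes> t \<otimes> y) = \<one>"
    and "(x \<otimes> y) [^] (3::nat) = \<one> \<Longrightarrow> (y \<otimes> t) [^] (4::nat) = \<one> \<Longrightarrow>
      (x \<otimes> (y \<otimes> t \<otimes> y)) [^] (4::nat) = \<one>"
    and "(x \<otimes> y) [^] (2::nat) = \<one> \<Longrightarrow> (x \<otimes> (y \<otimes> t \<otimes> y)) [^] (2::nat) = \<one>"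
proof -
  note [simp] = c sq m_assoc involution_cancel
  have tx: "t \<otimes> x = x \<otimes> t" by (rule involutions_commute) (use xt in simp_all)
  have tx': "t \<otimes> (x \<otimes> a) = x \<otimes> (t \<otimes> a)" if "a \<in> carrier G" for a
    using that tx m_assoc[of t x a] m_assoc[of x t a] c by metis
  show z: "(y \<otimes> t \<otimes> y) \<otimes> (y \<otimes> t \<otimes> y) = \<one>" by simp
  show "(x \<otimes> (y \<otimes> t \<otimes> y)) [^] (4::nat) = \<one>"
    if xy: "(x \<otimes> y) [^] (3::nat) = \<one>" and yt: "(y \<otimes> t) [^] (4::nat) = \<one>"
  proof -
    have "inv (y \<otimes> x \<otimes> y) = x \<otimes> y \<otimes> x"
      using xy by (intro inv_equality) (simp_all add: numeral_3_eq_3)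
    moreover have "inv (y \<otimes> x \<otimes> y) = y \<otimes> x \<otimes> y"
      by (intro inv_equality) simp_all
    ultimately have br: "y \<otimes> (x \<otimes> y) = x \<otimes> (y \<otimes> x)" by simp
    have i: "inv (y \<otimes> x) = x \<otimes> y" by (intro inv_equality) simp_all
    have "(y \<otimes> x) \<otimes> (y \<otimes> t) \<otimes> inv (y \<otimes> x) = (y \<otimes> (x \<otimes> y)) \<otimes> (x \<otimes> (t \<otimes> y))"
      unfolding i by (simp add: tx')
    also have "\<dots> = x \<otimes> (y \<otimes> t \<otimes> y)" unfolding br by simp
    finally show ?thesis
      using conj_pow[of "y \<otimes> x" "y \<otimes> t" 4] yt by (simp del: m_assoc)
  qed
  show "(x \<otimes> (y \<otimes> t \<otimes> y)) [^] (2::nat) = \<one>" if xy: "(x \<otimes> y) [^] (2::nat) = \<one>"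
  proof -
    have yx: "y \<otimes> x = x \<otimes> y" by (rule involutions_commute) (use xy in simp_all)
    have yx': "y \<otimes> (x \<otimes> a) = x \<otimes> (y \<otimes> a)" if "a \<in> carrier G" for a
      using that yx m_assoc[of y x a] m_assoc[of x y a] c by metis
    show ?thesis by (simp add: numeral_2_eq_2 tx' yx')
  qed
qed

end

lemma ex1_tower_hom:
  assumes diag: "\<And>s. s \<in> gens A \<Longrightarrow> cmat A s s = 1" "\<And>s. s \<in> gens A' \<Longrightarrow> cmat A' s s = 1"
    and gens: "T n \<in> gens A" "Sig n \<in> gens A'" "T (n + 1) \<in> gens A'" "gens A - {T n} \<subseteq> gens A'"
    and agree: "\<And>s t. s \<in> gens A - {T n} \<Longrightarrow> t \<in> gens A - {T n} \<Longrightarrow> cmat A s t = cmat A' s t"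
    and yt: "cmat A' (Sig n) (T (n + 1)) = 4"
    and xt: "\<And>s. s \<in> gens A - {T n} \<Longrightarrow> cmat A' s (T (n + 1)) = 2"
    and x: "\<And>s. s \<in> gens A - {T n} \<Longrightarrow> cmat A s (T n) = cmat A (T n) s \<and>
      (cmat A s (T n) = 4 \<and> cmat A' s (Sig n) = 3 \<or> cmat A s (T n) = 2 \<and> cmat A' s (Sig n) = 2)"
  shows "\<exists>!f. is_tower_hom n A A' f"
proof -
  let ?H = "cox_group A'"
  interpret H: group ?H by (rule group_cox_group) (rule diag(2))
  define z where "z = cox_gen A' (Sig n) \<otimes>\<^bsub>?H\<^esub> cox_gen A' (T (n + 1)) \<otimes>\<^bsub>?H\<^esub> cox_gen A' (Sig n)"
  define g where "g s = (if s = T n then z else cox_gen A' s)" for s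
  have cl: "cox_gen A' s \<in> carrier ?H" if "s \<in> gens A'" for s
    using that by (rule cox_gen_closed)
  have zc: "z \<in> carrier ?H" using cl gens by (simp add: z_def)
  have rel: "(cox_gen A' s \<otimes>\<^bsub>?H\<^esub> cox_gen A' t) [^]\<^bsub>?H\<^esub> cmat A' s t = \<one>\<^bsub>?H\<^esub>"
    if "s \<in> gens A'" "t \<in> gens A'" for s t
    by (rule cox_gen_relation) (use that diag in auto)
  have sq: "cox_gen A' s \<otimes>\<^bsub>?H\<^esub> cox_gen A' s = \<one>\<^bsub>?H\<^esub>" if "s \<in> gens A'" for s
    using rel[OF that that] diag(2)[OF that] cl[OF that] by simp
  have zz: "z \<otimes>\<^bsub>?H\<^esub> z = \<one>\<^bsub>?H\<^esub>"
    unfolding z_def using H.tower_relations(1)[of "\<one>\<^bsub>?H\<^esub>"] cl sq gens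
    by (simp add: numeral_2_eq_2)
  have sz: "(cox_gen A' s \<otimes>\<^bsub>?H\<^esub> z) [^]\<^bsub>?H\<^esub> cmat A s (T n) = \<one>\<^bsub>?H\<^esub>"
    if s: "s \<in> gens A - {T n}" for s
  proof -
    have s': "s \<in> gens A'" using s gens by auto
    note r = H.tower_relations[OF cl[OF s'] cl[OF gens(2)] cl[OF gens(3)]
      sq[OF s'] sq[OF gens(2)] sq[OF gens(3)]]
    show ?thesis
      using x[OF s] r(2,3) rel[OF s' gens(2)] rel[OF s' gens(3)] rel[OF gens(2,3)] xt[OF s] yt
      unfolding z_def by metis
  qed
  have "\<exists>!f. f \<in> hom (cox_group A) ?H \<and> f \<in> extensional (carrier (cox_group A)) \<and>
    (\<forall>s\<in>gens A. f (cox_gen A s) = g s)"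
  proof (rule cox_group_universal[OF H.is_group])
    show "g s \<in> carrier ?H" if "s \<in> gens A" for s
      using that cl zc gens by (auto simp: g_def)
    show "(g s \<otimes>\<^bsub>?H\<^esub> g t) [^]\<^bsub>?H\<^esub> cmat A s t = \<one>\<^bsub>?H\<^esub>" if st: "s \<in> gens A" "t \<in> gens A" for s t
    proof -
      consider "s = T n" "t = T n" | "s \<noteq> T n" "t = T n" | "s = T n" "t \<noteq> T n"
        | "s \<noteq> T n" "t \<noteq> T n" by blast
      then show ?thesis
      proof cases
        case 1
        then show ?thesis using zz zc diag(1)[OF gens(1)] by (simp add: g_def)
      next
        case 2
        then show ?thesis using sz st by (simp add: g_def)
      next
        case 3
        then have "t \<in> gens A - {T n}" "t \<in> gens A'" using st gens by auto
        then show ?thesis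
          using 3 x[of t] H.involutions_pow_swap[of "cox_gen A' t" z] sz[of t] cl[of t] zc sq[of t] zz
          by (simp add: g_def)
      next
        case 4
        then show ?thesis using rel[of s t] agree[of s t] st gens by (auto simp: g_def)
      qed
    qed
  qed (use diag in auto)
  moreover have "(\<forall>s\<in>gens A. f (cox_gen A s) = g s) \<longleftrightarrow>
    (\<forall>s\<in>gens A - {T n}. f (cox_gen A s) = cox_gen A' s) \<and> f (cox_gen A (T n)) = z" for f
    using gens(1) by (auto simp: g_def)
  ultimately show ?thesis by (simp add: is_tower_hom_def z_def)
qed

lemma cmat_diag [simp]: "cmat (C_tilde n) s s = 1" "cmat (B_tilde n) s s = 1"
  by (simp_all add: C_tilde_def B_tilde_def)

lemma is_tower_hom_F_hom:
  assumes "n \<ge> 2"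
  shows "is_tower_hom n (C_tilde n) (C_tilde (n + 1)) (F_hom n)"
  unfolding F_hom_def
proof (rule theI'[OF ex1_tower_hom])
  show "T n \<in> gens (C_tilde n)" "Sig n \<in> gens (C_tilde (n + 1))" "T (n + 1) \<in> gens (C_tilde (n + 1))"
    "gens (C_tilde n) - {T n} \<subseteq> gens (C_tilde (n + 1))"
    using assms by (auto simp: C_tilde_def)
  show "cmat (C_tilde n) s t = cmat (C_tilde (n + 1)) s t"
    if "s \<in> gens (C_tilde n) - {T n}" "t \<in> gens (C_tilde n) - {T n}" for s t
  proof -
    have "(\<exists>i\<ge>1. i \<le> n - 2 \<and> {s, t} = {Sig i, Sig (i + 1)}) \<longleftrightarrow>
      (\<exists>i\<ge>1. i \<le> n + 1 - 2 \<and> {s, t} = {Sig i, Sig (i + 1)})"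
      using that assms by (auto simp: C_tilde_def doubleton_eq_iff)
    moreover have "{s, t} \<noteq> {Sig (n - 1), T n}" "{s, t} \<noteq> {Sig (n + 1 - 1), T (n + 1)}"
      using that by (auto simp: C_tilde_def doubleton_eq_iff)
    ultimately show ?thesis by (simp add: C_tilde_def)
  qed
  show "cmat (C_tilde (n + 1)) (Sig n) (T (n + 1)) = 4"
    using assms by (simp add: C_tilde_def doubleton_eq_iff)
  show "cmat (C_tilde (n + 1)) s (T (n + 1)) = 2" if "s \<in> gens (C_tilde n) - {T n}" for s
    using that assms by (auto simp: C_tilde_def doubleton_eq_iff)
  show "cmat (C_tilde n) s (T n) = cmat (C_tilde n) (T n) s \<and>
      (cmat (C_tilde n) s (T n) = 4 \<and> cmat (C_tilde (n + 1)) s (Sig n) = 3 \<or>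
       cmat (C_tilde n) s (T n) = 2 \<and> cmat (C_tilde (n + 1)) s (Sig n) = 2)"
    if s: "s \<in> gens (C_tilde n) - {T n}" for s
  proof (cases "s = Sig (n - 1)")
    case True
    then show ?thesis using assms by (auto simp: C_tilde_def doubleton_eq_iff)
  next
    case False
    then obtain i where "s = Sig i" "i < n" using s by (auto simp: C_tilde_def)
    moreover from this False have "i + 1 < n" by (cases "i = n - 1") auto
    ultimately show ?thesis using assms by (simp add: C_tilde_def doubleton_eq_iff)
  qed
qed simp_all

lemma is_tower_hom_L_hom:
  assumes "n \<ge> 3"
  shows "is_tower_hom n (B_tilde n) (B_tilde (n + 1)) (L_hom n)"
  unfolding L_hom_def
proof (rule theI'[OF ex1_tower_hom])
  show "T n \<in> gens (B_tilde n)" "Sig n \<in> gens (B_tilde (n + 1))" "T (n + 1) \<in> gens (B_tilde (n + 1))"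
    "gens (B_tilde n) - {T n} \<subseteq> gens (B_tilde (n + 1))"
    using assms by (auto simp: B_tilde_def)
  show "cmat (B_tilde n) s t = cmat (B_tilde (n + 1)) s t"
    if "s \<in> gens (B_tilde n) - {T n}" "t \<in> gens (B_tilde n) - {T n}" for s t
  proof -
    have "(\<exists>i\<ge>1. i \<le> n - 2 \<and> {s, t} = {Sig i, Sig (i + 1)}) \<longleftrightarrow>
      (\<exists>i\<ge>1. i \<le> n + 1 - 2 \<and> {s, t} = {Sig i, Sig (i + 1)})"
      using that assms by (auto simp: B_tilde_def doubleton_eq_iff)
    moreover have "{s, t} \<noteq> {Sig (n - 1), T n}" "{s, t} \<noteq> {Sig (n + 1 - 1), T (n + 1)}"
      using that by (auto simp: B_tilde_def doubleton_eq_iff)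
    ultimately show ?thesis by (simp add: B_tilde_def)
  qed
  show "cmat (B_tilde (n + 1)) (Sig n) (T (n + 1)) = 4"
    using assms by (simp add: B_tilde_def doubleton_eq_iff)
  show "cmat (B_tilde (n + 1)) s (T (n + 1)) = 2" if "s \<in> gens (B_tilde n) - {T n}" for s
    using that assms by (auto simp: B_tilde_def doubleton_eq_iff)
  show "cmat (B_tilde n) s (T n) = cmat (B_tilde n) (T n) s \<and>
      (cmat (B_tilde n) s (T n) = 4 \<and> cmat (B_tilde (n + 1)) s (Sig n) = 3 \<or>
       cmat (B_tilde n) s (T n) = 2 \<and> cmat (B_tilde (n + 1)) s (Sig n) = 2)"
    if s: "s \<in> gens (B_tilde n) - {T n}" for s
  proof (cases "s = Sig (n - 1)")
    case True
    then show ?thesis using assms by (auto simp: B_tilde_def doubleton_eq_iff)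
  next
    case False
    consider "s = SigBar" | i where "s = Sig i" "i + 1 < n"
    proof (cases s)
      case (Sig i)
      then have "i < n" "i \<noteq> n - 1" using s False by (auto simp: B_tilde_def)
      then show ?thesis using Sig that(2)[of i] by simp
    qed (use s that in \<open>auto simp: B_tilde_def\<close>)
    then show ?thesis
      by cases (use assms in \<open>simp_all add: B_tilde_def doubleton_eq_iff\<close>)
  qed
qed simp_all

end

theory Submission
  imports Defs
begin

text \<open>
  To each word in the generators of a Coxeter group belong its reflections, the elements of the
  multiset \<open>Phi\<close>, and, for an action by reflections on a space, its roots. If the roots are pairwise
  independent, then the reflections are distinct (\<open>distinct_reflections\<close>), as they already differ as
  linear maps. Distinct reflections make a word reduced (\<open>red_if_distinct_reflections\<close>), because the
  parity of the multiplicity of a reflection depends only on the group element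
  (\<open>even_count_reflections\<close>). Conversely, a reduced word has pairwise independent roots
  (\<open>indep_roots\<close>), by Tits' theorem that \<open>w s > w\<close> implies that \<open>w\<close> sends the simple root of \<open>s\<close>
  to a positive root (\<open>ht_act_root_pos\<close>). Faithfulness of the action, or injectivity of the tower
  homomorphism, is not needed separately.

  Let all groups of both towers act on affine functions in the coordinates \<open>x\<^sub>1, x\<^sub>2, \<dots>\<close>, with
  \<open>t\<^sub>m\<close> as the reflection \<open>x\<^sub>m \<mapsto> 1 - x\<^sub>m\<close>. Then \<open>t\<^sub>n\<close> and \<open>\<sigma>\<^sub>n t\<^sub>n\<^sub>+\<^sub>1 \<sigma>\<^sub>n\<close> act by the same map, so the
  roots of the substituted word can be read off from the roots \<open>\<beta>\<close> of the reduced word \<open>e\<close>: a letter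
  other than \<open>t\<^sub>n\<close> again yields \<open>\<beta>\<close>, and a letter \<open>t\<^sub>n\<close> yields \<open>\<beta> - \<tau>\<close>, \<open>\<beta>\<close>, \<open>\<beta> + \<tau>\<close>, where
  \<open>\<tau> = 1/2 - x\<^sub>n\<^sub>+\<^sub>1\<close> is fixed by the smaller group. Since the \<open>\<beta>\<close> are pairwise independent and do not
  involve \<open>x\<^sub>n\<^sub>+\<^sub>1\<close>, these roots are pairwise independent too (\<open>indep_roots_subst_word\<close>). Hence the
  reflections of the substituted word are distinct and the word is reduced.

  Its length is the length of \<open>e\<close> plus twice the number of letters \<open>t\<^sub>n\<close> in \<open>e\<close>. This number is the
  same for all reduced words of an element (\<open>letter_length_eq\<close>): reduced words of one element have
  the same set of reflections, and the reflections coming from \<open>t\<^sub>n\<close> are those on which the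
  homomorphism to \<open>\<int>/2\<close> that counts the letter \<open>t\<^sub>n\<close> is nontrivial.
\<close>

section \<open>The reflections of a word\<close>

context group
begin

text \<open>
  The conjugates \<open>(x\<^sub>1 \<dots> x\<^sub>j\<^sub>-\<^sub>1) x\<^sub>j (x\<^sub>1 \<dots> x\<^sub>j\<^sub>-\<^sub>1)\<inverse>\<close>, listed in the order of \<open>j\<close>; their multiset
  is \<open>Phi\<close>. The recursion on the first letter replaces prefix products by one conjugation per step.
\<close>

primrec refl_list :: "'a list \<Rightarrow> 'a list" where
  "refl_list [] = []"
| "refl_list (x # xs) = x # map (\<lambda>h. x \<otimes> h \<otimes> inv x) (refl_list xs)"

lemma refl_list_closed: "set xs \<subseteq> carrier G \<Longrightarrow> set (refl_list xs) \<subseteq> carrier G"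
  by (induction xs) auto

lemma length_refl_list [simp]: "length (refl_list xs) = length xs"
  by (induction xs) auto

lemma Phi_eq_refl_list:
  assumes "set xs \<subseteq> carrier G"
  shows "Phi G xs = mset (refl_list xs)"
proof -
  have "map (\<lambda>j. list_prod G (take j xs) \<otimes> (xs ! j) \<otimes> inv (list_prod G (take j xs))) [0..<length xs]
      = refl_list xs" if "set xs \<subseteq> carrier G" for xs
    using that
  proof (induction xs)
    case (Cons x xs)
    have x: "x \<in> carrier G" and xs: "set xs \<subseteq> carrier G" using Cons.prems by auto
    have "list_prod G (x # take j xs) \<otimes> (xs ! j) \<otimes> inv (list_prod G (x # take j xs))
      = x \<otimes> (list_prod G (take j xs) \<otimes> (xs ! j) \<otimes> inv (list_prod G (take j xs))) \<otimes> inv x"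
      if "j < length xs" for j
    proof -
      have "list_prod G (take j xs) \<in> carrier G"
        using xs set_take_subset by (intro list_prod_closed) fastforce
      moreover have "xs ! j \<in> carrier G" using xs that by auto
      moreover have "list_prod G (x # take j xs) = x \<otimes> list_prod G (take j xs)"
        by (simp add: list_prod_def)
      ultimately show ?thesis using x by (simp add: m_assoc inv_mult_group)
    qed
    then show ?case using x
      by (simp add: map_upt_Suc Cons.IH[OF xs, symmetric] list_prod_def del: upt_Suc)
  qed simp
  then show ?thesis using assms by (simp add: Phi_def)
qed

lemma refl_list_append:
  assumes "set xs \<subseteq> carrier G" "set ys \<subseteq> carrier G"
  shows "refl_list (xs @ ys) =
    refl_list xs @ map (\<lambda>h. list_prod G xs \<otimes> h \<otimes> inv (list_prod G xs)) (refl_list ys)"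
  using assms(1)
proof (induction xs)
  case Nil
  have "map (\<lambda>h. \<one> \<otimes> h \<otimes> inv \<one>) (refl_list ys) = map id (refl_list ys)"
    using refl_list_closed[OF assms(2)] by (intro map_cong) auto
  then show ?case by (simp add: list_prod_def)
next
  case (Cons x xs)
  have x: "x \<in> carrier G" and p: "list_prod G xs \<in> carrier G"
    using Cons.prems by (auto intro: list_prod_closed)
  have "map (\<lambda>h. x \<otimes> (list_prod G xs \<otimes> h \<otimes> inv list_prod G xs) \<otimes> inv x) (refl_list ys)
      = map (\<lambda>h. list_prod G (x # xs) \<otimes> h \<otimes> inv list_prod G (x # xs)) (refl_list ys)"
    using refl_list_closed[OF assms(2)] x p
    by (intro map_cong) (auto simp: list_prod_def m_assoc inv_mult_group)
  then show ?case using Cons by (simp add: comp_def)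
qed

text \<open>
  The reflections of an alternating word \<open>s t s t \<dots>\<close> are \<open>(s t)\<^sup>j s\<close>, so they repeat with
  the period of \<open>s t\<close>.
\<close>

lemma refl_list_alternating:
  assumes c: "s \<in> carrier G" "t \<in> carrier G" and sq: "s \<otimes> s = \<one>" "t \<otimes> t = \<one>"
  shows "refl_list (concat (replicate k [s, t])) = map (\<lambda>j. (s \<otimes> t) [^] j \<otimes> s) [0..<2 * k]"
proof (induction k)
  case (Suc k)
  let ?x = "s \<otimes> t"
  have i: "inv s = s" "inv t = t" using c sq by (auto intro: inv_equality)
  have "s \<otimes> (t \<otimes> (?x [^] j \<otimes> s) \<otimes> inv t) \<otimes> inv s = ?x [^] (j + 2) \<otimes> s" for j :: nat
  proof -
    have "?x [^] (j + 2) = ?x \<otimes> ?x [^] j \<otimes> ?x"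
      using c nat_pow_mult[of ?x 1 j] nat_pow_mult[of ?x "j + 1" 1] by simp
    then show ?thesis using c i by (simp add: m_assoc)
  qed
  moreover have "[0..<2 * Suc k] = 0 # 1 # map (\<lambda>j. j + 2) [0..<2 * k]"
    using map_add_upt[of 2 "2 * k"] by (simp add: upt_conv_Cons numeral_2_eq_2 del: upt_Suc)
  ultimately show ?case using c i Suc by (simp add: comp_def del: upt_Suc)
qed simp

lemma even_count_refl_list_relator:
  assumes c: "s \<in> carrier G" "t \<in> carrier G" and sq: "s \<otimes> s = \<one>" "t \<otimes> t = \<one>"
    and m: "(s \<otimes> t) [^] (m::nat) = \<one>"
  shows "even (count (mset (refl_list (concat (replicate m [s, t])))) h)"
proof -
  let ?f = "\<lambda>j::nat. (s \<otimes> t) [^] j \<otimes> s"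
  have "?f (j + m) = ?f j" for j :: nat
    using nat_pow_mult[of "s \<otimes> t" j m, symmetric] c m by simp
  then have "map ?f [0..<m + m] = map ?f [0..<m] @ map ?f [0..<m]"
    by (intro nth_equalityI) (auto simp: nth_append, metis le_add_diff_inverse2 linorder_not_le)
  then show ?thesis
    using refl_list_alternating[OF c sq, of m] by (simp add: mult_2)
qed

end

locale coxeter =
  fixes A :: "'s coxeter_datum"
  assumes diag: "s \<in> gens A \<Longrightarrow> cmat A s s = 1"
begin

abbreviation G where "G \<equiv> cox_group A"

sublocale G: group G by (rule group_cox_group) (rule diag)

abbreviation reflections :: "'s list \<Rightarrow> 's list set list" where
  "reflections e \<equiv> G.refl_list (map (cox_gen A) e)"

lemma gens_closed: "e \<in> lists (gens A) \<Longrightarrow> set (map (cox_gen A) e) \<subseteq> carrier G"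
  using cox_gen_closed by fastforce

lemma word_Phi_eq: "e \<in> lists (gens A) \<Longrightarrow> word_Phi A e = mset (reflections e)"
  unfolding word_Phi_def by (intro G.Phi_eq_refl_list gens_closed)

lemma word_val_closed: "e \<in> lists (gens A) \<Longrightarrow> word_val A e \<in> carrier G"
  by (auto simp: carrier_cox_group)

lemma word_val_eq_iff:
  "e \<in> lists (gens A) \<Longrightarrow> e' \<in> lists (gens A) \<Longrightarrow> word_val A e = word_val A e' \<longleftrightarrow> cox_eq A e e'"
  by (simp add: word_val_eq_cox_class cox_class_eq_iff)

lemma word_val_append:
  "e \<in> lists (gens A) \<Longrightarrow> e' \<in> lists (gens A) \<Longrightarrow>
    word_val A (e @ e') = word_val A e \<otimes>\<^bsub>G\<^esub> word_val A e'"
  by (simp add: word_val_eq_cox_class mult_cox_class)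

lemma cox_gen_sq: "s \<in> gens A \<Longrightarrow> cox_gen A s \<otimes>\<^bsub>G\<^esub> cox_gen A s = \<one>\<^bsub>G\<^esub>"
  using cox_gen_relation[of A s s] diag cox_gen_closed[of s A] by simp

text \<open>
  The multiplicity modulo 2 of a group element among the reflections of a word depends only on
  the value of the word: a relator is trivial in the group and contributes each of its reflections
  an even number of times.
\<close>

lemma even_count_reflections:
  assumes "cox_eq A e e'"
  shows "even (count (mset (reflections e)) h + count (mset (reflections e')) h)"
  using assms
proof (induction rule: cox_eq.induct)
  case (relator s t u v)
  let ?r = "concat (replicate (cmat A s t) [s, t])"
  have r: "?r \<in> lists (gens A)" using relator by (auto simp: in_lists_conv_set)
  have rel: "cox_eq A ?r []" using cox_eq.relator[of s A t "[]" "[]"] relator by simp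
  have r1: "word_val A ?r = \<one>\<^bsub>G\<^esub>"
    using word_val_eq_iff[of ?r "[]"] r rel by (simp add: word_val_def list_prod_def)
  let ?c = "\<lambda>h. word_val A u \<otimes>\<^bsub>G\<^esub> h \<otimes>\<^bsub>G\<^esub> inv\<^bsub>G\<^esub> word_val A u"
  have u: "reflections (u @ e) = reflections u @ map ?c (reflections e)"
    if "e \<in> lists (gens A)" for e
    using G.refl_list_append[OF gens_closed gens_closed, of u e] relator that
    by (simp add: word_val_def)
  have "map (\<lambda>h. \<one>\<^bsub>G\<^esub> \<otimes>\<^bsub>G\<^esub> h \<otimes>\<^bsub>G\<^esub> inv\<^bsub>G\<^esub> \<one>\<^bsub>G\<^esub>) (reflections v) = map id (reflections v)"
    using G.refl_list_closed[OF gens_closed, of v] relator by (intro map_cong) auto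
  then have rv: "reflections (?r @ v) = reflections ?r @ reflections v"
    using G.refl_list_append[OF gens_closed gens_closed, of ?r v] relator r r1
    by (simp add: word_val_def)
  have "even (count (mset (reflections ?r)) h)" for h
    using G.even_count_refl_list_relator[OF cox_gen_closed cox_gen_closed cox_gen_sq cox_gen_sq
        cox_gen_relation, of s t h] relator diag
    by (simp add: map_concat)
  then have ev: "even (count (mset (map ?c (reflections ?r))) h)"
    unfolding mset_map count_image_mset by (intro dvd_sum) simp
  have "reflections (u @ ?r @ v) = reflections u @ map ?c (reflections ?r) @ map ?c (reflections v)"
    using u[of "?r @ v"] r relator rv by simp
  moreover have "reflections (u @ v) = reflections u @ map ?c (reflections v)"
    using u relator by simp
  ultimately show ?case using ev by (simp only: mset_append count_union) presburger
qed auto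

text \<open>
  Reduced words, described by the congruence on words alone.
\<close>

definition red :: "'s list \<Rightarrow> bool" where
  "red e \<longleftrightarrow> e \<in> lists (gens A) \<and> (\<forall>e'. cox_eq A e e' \<longrightarrow> length e \<le> length e')"

lemma reduced_expr_iff:
  "reduced_expr A e w \<longleftrightarrow> red e \<and> word_val A e = w"
proof (cases "e \<in> lists (gens A) \<and> word_val A e = w")
  case True
  let ?P = "\<lambda>r. \<exists>e'\<in>lists (gens A). word_val A e' = w \<and> length e' = r"
  have P: "?P r \<longleftrightarrow> (\<exists>e'. cox_eq A e e' \<and> length e' = r)" for r
    using True word_val_eq_iff[of e] cox_eq_lists[of A e] by metis
  have "?P (cox_length A w)"
    unfolding cox_length_def by (rule LeastI[of ?P "length e"]) (use True in blast)
  moreover have "cox_length A w \<le> r" if "?P r" for r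
    unfolding cox_length_def by (rule Least_le) (rule that)
  ultimately have "length e = cox_length A w \<longleftrightarrow> (\<forall>e'. cox_eq A e e' \<longrightarrow> length e \<le> length e')"
    using P True by (metis le_antisym cox_eq.refl)
  then show ?thesis using True by (simp add: reduced_expr_def red_def)
qed (auto simp: reduced_expr_def red_def)

text \<open>
  Distinct reflections have odd multiplicity, hence occur for every other word with the same
  value, which therefore is at least as long.
\<close>

lemma red_if_distinct_reflections:
  assumes e: "e \<in> lists (gens A)" and d: "distinct (reflections e)"
  shows "red e"
  unfolding red_def
proof (intro conjI e allI impI)
  fix e' assume eq: "cox_eq A e e'"
  have "set (reflections e) \<subseteq> set (reflections e')"
  proof
    fix h assume "h \<in> set (reflections e)"
    then have "count (mset (reflections e)) h = 1"
      using d by (simp add: distinct_count_atmost_1)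
    then have "count (mset (reflections e')) h \<noteq> 0"
      using even_count_reflections[OF eq, of h] by (metis add_0_right odd_one)
    then show "h \<in> set (reflections e')" by (metis count_mset_0_iff)
  qed
  then have "card (set (reflections e)) \<le> card (set (reflections e'))" by (simp add: card_mono)
  also have "\<dots> \<le> length e'" by (metis card_length G.length_refl_list length_map)
  finally show "length e \<le> length e'" using distinct_card[OF d] by simp
qed

text \<open>Multiplicities at most 1 are determined by their parity.\<close>

lemma mset_reflections_eq:
  assumes "cox_eq A e e'" "distinct (reflections e)" "distinct (reflections e')"
  shows "mset (reflections e) = mset (reflections e')"
proof (rule multiset_eqI)
  fix h
  show "count (mset (reflections e)) h = count (mset (reflections e')) h"
    using even_count_reflections[OF assms(1), of h] assms(2,3)
    by (cases "h \<in> set (reflections e)"; cases "h \<in> set (reflections e')")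
      (simp_all add: distinct_count_atmost_1)
qed

lemma conj_word_val:
  assumes s: "s \<in> gens A" and e: "e \<in> lists (gens A)"
  shows "cox_gen A s \<otimes>\<^bsub>G\<^esub> word_val A e \<otimes>\<^bsub>G\<^esub> inv\<^bsub>G\<^esub> cox_gen A s = word_val A ([s] @ e @ [s])"
proof -
  have g: "cox_gen A s = word_val A [s]" using s by (simp add: word_val_eq_cox_class cox_gen_def)
  have i: "inv\<^bsub>G\<^esub> cox_gen A s = cox_gen A s"
    using s cox_gen_closed cox_gen_sq by (intro G.inv_equality) auto
  show ?thesis
    unfolding i using word_val_append[of "[s]" "e @ [s]"] word_val_append[of e "[s]"]
      s e g cox_gen_closed[OF s] word_val_closed[OF e] by (simp add: G.m_assoc)
qed

end

section \<open>Words of minimal length\<close>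

context coxeter
begin

lemma red_lists: "red e \<Longrightarrow> e \<in> lists (gens A)"
  by (simp add: red_def)

lemma red_append:
  assumes "red (u @ v)"
  shows "red u" "red v"
proof -
  have uv: "u \<in> lists (gens A)" "v \<in> lists (gens A)" using red_lists[OF assms] by auto
  show "red u"
    unfolding red_def
  proof (intro conjI uv allI impI)
    fix e assume "cox_eq A u e"
    then have "cox_eq A (u @ v) (e @ v)" by (rule cox_eq_append_right) (rule uv)
    then have "length (u @ v) \<le> length (e @ v)" using assms unfolding red_def by blast
    then show "length u \<le> length e" by simp
  qed
  show "red v"
    unfolding red_def
  proof (intro conjI uv allI impI)
    fix e assume "cox_eq A v e"
    then have "cox_eq A (u @ v) (u @ e)" by (rule cox_eq_append_left) (rule uv)
    then have "length (u @ v) \<le> length (u @ e)" using assms unfolding red_def by blast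
    then show "length v \<le> length e" by simp
  qed
qed

lemma red_cong:
  assumes "red e" "cox_eq A e e'" "length e' = length e"
  shows "red e'"
  using assms cox_eq_lists[OF assms(2)] unfolding red_def by (metis cox_eq.trans)

lemma not_red_if_shorter: "cox_eq A e e' \<Longrightarrow> length e' < length e \<Longrightarrow> \<not> red e"
  by (auto simp: red_def)

lemma cox_eq_cancel:
  "x \<in> gens A \<Longrightarrow> u \<in> lists (gens A) \<Longrightarrow> v \<in> lists (gens A) \<Longrightarrow> cox_eq A (u @ [x, x] @ v) (u @ v)"
  using cox_eq.relator[of x A x u v] by (simp add: diag)

lemma cox_eq_rev_Nil:
  assumes "e \<in> lists (gens A)"
  shows "cox_eq A (e @ rev e) []"
  using assms
proof (induction e rule: rev_induct)
  case (snoc x e)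
  have "cox_eq A (e @ [x, x] @ rev e) (e @ rev e)"
    using snoc.prems by (intro cox_eq_cancel) (auto simp: in_lists_conv_set)
  then show ?case using snoc by (auto intro: cox_eq.trans)
qed (auto intro: cox_eq.refl)

lemma cox_eq_rev_if_append_Nil:
  assumes "cox_eq A (u @ v) []"
  shows "cox_eq A u (rev v)"
proof -
  have uv: "u \<in> lists (gens A)" "v \<in> lists (gens A)" "rev v \<in> lists (gens A)"
    using cox_eq_lists[OF assms] by (auto simp: in_lists_conv_set)
  have "cox_eq A (u @ v @ rev v) (u @ [])"
    by (intro cox_eq_append_left cox_eq_rev_Nil uv)
  moreover have "cox_eq A ((u @ v) @ rev v) ([] @ rev v)"
    by (intro cox_eq_append_right assms uv)
  ultimately show ?thesis by (simp, metis cox_eq.sym cox_eq.trans)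
qed

lemma cox_eq_even_length:
  "cox_eq A e e' \<Longrightarrow> even (length e) \<longleftrightarrow> even (length e')"
proof (induction rule: cox_eq.induct)
  case (relator s t u v)
  have "length (concat (replicate k [s, t])) = 2 * k" for k by (induction k) auto
  then show ?case by simp
qed auto

text \<open>
  If right multiplication by \<open>x\<close> does not lengthen an element, then by parity it shortens it, and
  the element has a reduced word ending in \<open>x\<close>.
\<close>

lemma right_descent:
  assumes e: "red e" and x: "x \<in> gens A" and n: "\<not> red (e @ [x])"
  obtains e' where "cox_eq A e (e' @ [x])" "length e = length e' + 1"
proof -
  have l: "e \<in> lists (gens A)" using e by (rule red_lists)
  obtain f where f: "cox_eq A (e @ [x]) f" "length f < length e + 1"
    using n l x by (auto simp: red_def not_le)
  have "cox_eq A ((e @ [x]) @ [x]) (f @ [x])"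
    by (rule cox_eq_append_right) (use f x in auto)
  moreover have "cox_eq A (e @ [x, x] @ []) (e @ [])" by (rule cox_eq_cancel) (use x l in auto)
  ultimately have ef: "cox_eq A e (f @ [x])" by (auto intro: cox_eq.intros)
  moreover have "length e \<le> length f + 1" using e ef by (force simp: red_def)
  then have "length e = length f + 1"
    using cox_eq_even_length[OF f(1)] f(2) by simp presburger
  ultimately show thesis by (rule that)
qed

end

section \<open>Alternating words\<close>

text \<open>The word of length \<open>k\<close> alternating between \<open>s\<close> and \<open>t\<close> with last letter \<open>t\<close>.\<close>

fun alt :: "'s \<Rightarrow> 's \<Rightarrow> nat \<Rightarrow> 's list" where
  "alt t s 0 = []"
| "alt t s (Suc k) = alt s t k @ [t]"

lemma length_alt [simp]: "length (alt t s k) = k"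
  by (induction t s k rule: alt.induct) auto

lemma set_alt: "set (alt t s k) \<subseteq> {s, t}"
  by (induction t s k rule: alt.induct) auto

lemma alt_suffix: "\<exists>p. alt t s (m + j) = p @ alt t s m"
proof (induction m arbitrary: s t)
  case (Suc m)
  then obtain p where "alt s t (m + j) = p @ alt s t m" by blast
  then show ?case by auto
qed auto

text \<open>Prepending one of the two letters either continues the alternation or doubles the first letter.\<close>

lemma Cons_alt:
  "x \<in> {s, t} \<Longrightarrow> x # alt t s (Suc k) = alt t s (Suc (Suc k)) \<or> alt t s (Suc k) = x # alt t s k"
proof (induction k arbitrary: s t)
  case (Suc k)
  have "x \<in> {t, s}" using Suc.prems by auto
  from Suc.IH[OF this] show ?case by (simp only: alt.simps append_Cons[symmetric]) auto
qed auto

section \<open>Integral root actions\<close>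

text \<open>
  Vectors are integer-valued functions. The generator \<open>s\<close> acts by the reflection
  \<open>v \<mapsto> v - ck s v \<cdot> root s\<close>, where \<open>ck s\<close> is the linear form given by the coroot of \<open>s\<close>.
  The last assumption is the usual correspondence between Cartan integers and the orders 2, 3, 4;
  it makes the reflections satisfy the Coxeter relations. Simple roots need not be linearly
  independent.
\<close>

locale root_action = coxeter A for A :: "'s coxeter_datum" +
  fixes root :: "'s \<Rightarrow> 'b \<Rightarrow> int" and ck :: "'s \<Rightarrow> ('b \<Rightarrow> int) \<Rightarrow> int"
  assumes ck_diff: "ck s (\<lambda>i. v i - c * v' i) = ck s v - c * ck s v'"
    and ck_root: "s \<in> gens A \<Longrightarrow> ck s (root s) = 2"
    and cartan: "s \<in> gens A \<Longrightarrow> t \<in> gens A \<Longrightarrow> s \<noteq> t \<Longrightarrow> cmat A t s = cmat A s t \<and>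
      (cmat A s t, ck s (root t), ck t (root s)) \<in> {(2, 0, 0), (3, -1, -1), (4, -1, -2), (4, -2, -1)}"
begin

text \<open>The reflection by which a generator acts, and the resulting action of words.\<close>

definition rf :: "'s \<Rightarrow> ('b \<Rightarrow> int) \<Rightarrow> 'b \<Rightarrow> int" where
  "rf s v = (\<lambda>i. v i - ck s v * root s i)"

definition act :: "'s list \<Rightarrow> ('b \<Rightarrow> int) \<Rightarrow> 'b \<Rightarrow> int" where
  "act e = foldr rf e"

lemma act_simps [simp]:
  "act [] v = v" "act (s # e) v = rf s (act e v)" "act (e @ e') v = act e (act e' v)"
  by (simp_all add: act_def)

lemma ck_comb: "ck s (\<lambda>i. x * v i + y * v' i) = x * ck s v + y * ck s v'"
proof -
  have z: "ck s (\<lambda>i. 0) = 0" using ck_diff[of s v 1 v] by simp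
  have "ck s (\<lambda>i. x * v i) = x * ck s v" using ck_diff[of s "\<lambda>i. 0" "-x" v] z by simp
  then show ?thesis using ck_diff[of s "\<lambda>i. x * v i" "-y" v'] by simp
qed

lemma rf_comb: "rf s (\<lambda>i. x * v i + y * v' i) = (\<lambda>i. x * rf s v i + y * rf s v' i)"
  by (simp add: rf_def ck_comb algebra_simps)

lemma act_comb: "act e (\<lambda>i. x * v i + y * v' i) = (\<lambda>i. x * act e v i + y * act e v' i)"
  by (induction e) (simp_all add: rf_comb)

lemma rf_root: "s \<in> gens A \<Longrightarrow> rf s (root s) = (\<lambda>i. - root s i)"
  by (simp add: rf_def ck_root)

lemma rf_rf: "s \<in> gens A \<Longrightarrow> rf s (rf s v) = v"
  by (simp add: rf_def ck_diff ck_root)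

text \<open>
  The orbit of \<open>v\<close> under two generators stays in a coset of the plane spanned by their roots. Kept
  as a constant, so that products of the two reflections are computed on the coordinates \<open>x\<close>, \<open>y\<close>.
\<close>

definition plane :: "('b \<Rightarrow> int) \<Rightarrow> 's \<Rightarrow> 's \<Rightarrow> int \<Rightarrow> int \<Rightarrow> 'b \<Rightarrow> int" where
  "plane v s t x y = (\<lambda>i. v i + (x * root s i + y * root t i))"

lemma ck_plane: "ck u (plane v s t x y) = ck u v + (x * ck u (root s) + y * ck u (root t))"
  using ck_comb[of u 1 v 1 "\<lambda>i. x * root s i + y * root t i"] by (simp add: plane_def ck_comb)

lemma rf_plane:
  "s \<in> gens A \<Longrightarrow> rf s (plane v s t x y) = plane v s t (- ck s v - x - y * ck s (root t)) y"
  "t \<in> gens A \<Longrightarrow> rf t (plane v s t x y) = plane v s t x (- ck t v - y - x * ck t (root s))"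
  unfolding rf_def[of _ "plane v s t x y"] ck_plane
  by (simp_all add: ck_root plane_def algebra_simps)

lemma act_relator:
  assumes st: "s \<in> gens A" "t \<in> gens A"
  shows "act (concat (replicate (cmat A s t) [s, t])) v = v"
proof (cases "s = t")
  case True
  then show ?thesis using st by (simp add: diag rf_rf)
next
  case False
  have v: "v = plane v s t 0 0" by (simp add: plane_def)
  show ?thesis
    by (subst (1 2) v, use cartan[OF st False] in \<open>elim conjE insertE emptyE\<close>)
      (simp_all add: numeral_eq_Suc rf_plane st algebra_simps)
qed

lemma act_cox_eq: "cox_eq A e e' \<Longrightarrow> act e v = act e' v"
  by (induction arbitrary: v rule: cox_eq.induct) (simp_all add: act_relator)

end

section \<open>Positivity of roots\<close>

text \<open>
  A linear form \<open>ht\<close> that is positive on the simple roots replaces the notion of a positive root.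
\<close>

locale positive_root_action = root_action A root ck
  for A :: "'s coxeter_datum" and root :: "'s \<Rightarrow> 'b \<Rightarrow> int" and ck +
  fixes ht :: "('b \<Rightarrow> int) \<Rightarrow> int"
  assumes ht_comb: "ht (\<lambda>i. x * v i + y * v' i) = x * ht v + y * ht v'"
    and ht_root: "s \<in> gens A \<Longrightarrow> ht (root s) > 0"
begin

text \<open>
  The dihedral case of positivity: an alternating word \<open>d\<close> in \<open>s\<close> and \<open>t\<close> that ends in \<open>t\<close> and is
  shorter than the order of \<open>s t\<close> sends \<open>root s\<close> to a nonnegative combination of the two roots.
\<close>

lemma act_alt_root:
  assumes st: "s \<in> gens A" "t \<in> gens A" "s \<noteq> t" and k: "0 < k" "k < cmat A s t"
  obtains x y where "x \<ge> 0" "y \<ge> 0" "x + y > 0"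
    "act (alt t s k) (root s) = (\<lambda>i. x * root s i + y * root t i)"
proof -
  let ?P = "plane (\<lambda>i. 0) s t" and ?a = "ck s (root t)" and ?b = "ck t (root s)"
  have 0: "root s = ?P 1 0" by (simp add: plane_def)
  have z: "ck u (\<lambda>i. 0) = 0" for u using ck_comb[of u 0 "root s" 0 "root s"] by simp
  note p = rf_plane st z numeral_eq_Suc
  have 1: "act (alt t s 1) (root s) = ?P 1 (- ?b)"
    by (subst 0) (simp add: p)
  have 2: "act (alt t s 2) (root s) = ?P (?a * ?b - 1) (- ?b)"
    by (subst 0) (simp add: p algebra_simps)
  have 3: "act (alt t s 3) (root s) = ?P (?a * ?b - 1) (?b - (?a * ?b - 1) * ?b)"
    by (subst 0) (simp add: p algebra_simps)
  note c = cartan[OF st]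
  from k c consider "k = 1" | "k = 2" "cmat A s t \<noteq> 2" | "k = 3" "cmat A s t = 4" by fastforce
  then show thesis
  proof cases
    case 1
    then show ?thesis using that[of 1 "- ?b"] \<open>act (alt t s 1) (root s) = _\<close> c
      by (auto simp: plane_def)
  next
    case 2
    then show ?thesis using that[of "?a * ?b - 1" "- ?b"] \<open>act (alt t s 2) (root s) = _\<close> c
      by (auto simp: plane_def)
  next
    case 3
    then show ?thesis
      using that[of "?a * ?b - 1" "?b - (?a * ?b - 1) * ?b"] \<open>act (alt t s 3) (root s) = _\<close> c
      by (auto simp: plane_def)
  qed
qed

text \<open>
  Tits' positivity theorem: if \<open>e\<close> followed by \<open>s\<close> is reduced, then \<open>e\<close> sends \<open>root s\<close> to a positive
  root. Let \<open>t\<close> be the last letter of \<open>e\<close>, and write \<open>e\<close> as \<open>v\<close> times an alternating word in \<open>s\<close>, \<open>t\<close>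
  that is as long as possible. Then \<open>v\<close> stays reduced when followed by \<open>s\<close> or by \<open>t\<close>, so the claim
  follows by induction from the dihedral case.
\<close>

theorem ht_act_root_pos:
  assumes "red (e @ [s])"
  shows "ht (act e (root s)) > 0"
  using assms
proof (induction "length e" arbitrary: e s rule: less_induct)
  case less
  have s: "s \<in> gens A" using red_lists[OF less.prems] by auto
  show ?case
  proof (cases e rule: rev_cases)
    case Nil
    then show ?thesis using s by (simp add: ht_root)
  next
    case (snoc e0 t)
    have e: "e \<in> lists (gens A)" "e0 \<in> lists (gens A)" "t \<in> gens A"
      using red_lists[OF less.prems] snoc by auto
    have "s \<noteq> t"
    proof
      assume "s = t"
      then have "cox_eq A (e @ [s]) e0" using cox_eq_cancel[of t e0 "[]"] e snoc by simp
      then have "\<not> red (e @ [s])" by (rule not_red_if_shorter) (simp add: snoc)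
      then show False using less.prems by blast
    qed
    define P where "P k \<longleftrightarrow> (\<exists>v. cox_eq A e (v @ alt t s k) \<and> length e = length v + k)" for k
    have P1: "P 1" unfolding P_def
      by (rule exI[of _ e0]) (use cox_eq.refl[OF e(1)] snoc in simp)
    have Pb: "k \<le> length e" if "P k" for k using that by (auto simp: P_def)
    define k where "k = Greatest P"
    have Pk: "P k" unfolding k_def by (rule GreatestI_nat[of P 1 "length e"]) (use P1 Pb in auto)
    have max: "j \<le> k" if "P j" for j
      unfolding k_def by (rule Greatest_le_nat[of P j "length e"]) (use that Pb in auto)
    then have k1: "k \<ge> 1" using P1 by auto
    obtain v where v: "cox_eq A e (v @ alt t s k)" "length e = length v + k"
      using Pk by (auto simp: P_def)
    have vl: "v \<in> lists (gens A)" using cox_eq_lists[OF v(1)] by auto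
    have re: "red (v @ alt t s k)"
      by (rule red_cong[OF red_append(1)[OF less.prems] v(1)]) (simp add: v)
    have rv: "red v" using re by (rule red_append)
    have res: "red (v @ alt t s k @ [s])"
      using red_cong[OF less.prems, of "(v @ alt t s k) @ [s]"] cox_eq_append_right[OF v(1), of "[s]"] v s
      by simp
    \<comment> \<open>Otherwise a braid relation shortens the alternating word followed by \<open>s\<close>.\<close>
    have km: "k < cmat A s t"
    proof (rule ccontr)
      assume "\<not> k < cmat A s t"
      then obtain j where "k = cmat A s t + j" using le_Suc_ex not_less by blast
      then obtain p where "alt t s k = p @ alt t s (cmat A s t)" using alt_suffix[of t s] by blast
      then have "red (v @ p @ (alt t s (cmat A s t) @ [s]))" using res by simp
      then have r: "red (alt t s (cmat A s t) @ [s])" by (metis red_append(2))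
      have rel: "cox_eq A (concat (replicate (cmat A a b) [a, b])) []" if "{a, b} = {s, t}" for a b
        using cox_eq.relator[of a A b "[]" "[]"] that s e by (auto simp: doubleton_eq_iff)
      note c = cartan[OF s e(3) \<open>s \<noteq> t\<close>]
      have "\<exists>w. cox_eq A (alt t s (cmat A s t) @ [s]) w \<and> length w < cmat A s t + 1"
      proof -
        consider "cmat A s t = 2" | "cmat A s t = 3" | "cmat A s t = 4" using c by auto
        then show ?thesis
        proof cases
          case 1
          then show ?thesis using rel[of s t] cox_eq_rev_if_append_Nil[of "[s, t, s]" "[t]"]
            by (intro exI[of _ "[t]"]) (simp add: numeral_eq_Suc)
        next
          case 2
          then show ?thesis using rel[of t s] c cox_eq_rev_if_append_Nil[of "[t, s, t, s]" "[t, s]"]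
            by (intro exI[of _ "[s, t]"]) (simp add: numeral_eq_Suc insert_commute)
        next
          case 3
          then show ?thesis
            using rel[of s t] cox_eq_rev_if_append_Nil[of "[s, t, s, t, s]" "[t, s, t]"]
            by (intro exI[of _ "[t, s, t]"]) (simp add: numeral_eq_Suc)
        qed
      qed
      then obtain w where w: "cox_eq A (alt t s (cmat A s t) @ [s]) w" "length w < cmat A s t + 1"
        by blast
      have "\<not> red (alt t s (cmat A s t) @ [s])" using w(1) by (rule not_red_if_shorter) (use w in simp)
      then show False using r by blast
    qed
    have IH: "ht (act v (root x)) > 0" if x: "x \<in> {s, t}" for x
    proof (rule less.hyps)
      show "length v < length e" using v k1 by simp
      show "red (v @ [x])"
      proof (rule ccontr)
        assume n: "\<not> red (v @ [x])"
        have xg: "x \<in> gens A" using x s e by auto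
        obtain v' where v': "cox_eq A v (v' @ [x])" "length v = length v' + 1"
          by (rule right_descent[OF rv xg n])
        have al: "alt t s i \<in> lists (gens A)" for i using set_alt[of t s i] s e by auto
        have "cox_eq A (v @ alt t s k) ((v' @ [x]) @ alt t s k)"
          using v'(1) al by (rule cox_eq_append_right)
        then have ev': "cox_eq A e (v' @ x # alt t s k)" using v(1) by (auto intro: cox_eq.trans)
        obtain j where j: "k = Suc j" using k1 by (cases k) auto
        \<comment> \<open>Moving \<open>x\<close> across either contradicts the maximality of \<open>k\<close> or shortens \<open>e\<close>.\<close>
        from Cons_alt[OF x, of j] show False
        proof
          assume "x # alt t s (Suc j) = alt t s (Suc (Suc j))"
          then have "cox_eq A e (v' @ alt t s (Suc k))" using ev' j by (simp del: alt.simps)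
          then have "P (Suc k)" using v v' by (auto simp: P_def simp del: alt.simps)
          then show False using max by fastforce
        next
          assume "alt t s (Suc j) = x # alt t s j"
          moreover have "v' \<in> lists (gens A)" using cox_eq_lists[OF v'(1)] by auto
          then have "cox_eq A (v' @ [x, x] @ alt t s j) (v' @ alt t s j)"
            using xg al by (intro cox_eq_cancel)
          ultimately have "cox_eq A e (v' @ alt t s j)"
            using ev' j by (auto intro: cox_eq.trans)
          then have "\<not> red e" by (rule not_red_if_shorter) (use j v v' in auto)
          then show False using red_append(1)[OF less.prems] by blast
        qed
      qed
    qed
    obtain x y where xy: "x \<ge> 0" "y \<ge> 0" "x + y > 0"
      "act (alt t s k) (root s) = (\<lambda>i. x * root s i + y * root t i)"
      using act_alt_root[OF s e(3) \<open>s \<noteq> t\<close> _ km] k1 by auto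
    have "act e (root s) = act (v @ alt t s k) (root s)" by (rule act_cox_eq) (rule v)
    also have "\<dots> = (\<lambda>i. x * act v (root s) i + y * act v (root t) i)"
      by (simp add: xy act_comb)
    finally have "ht (act e (root s)) = x * ht (act v (root s)) + y * ht (act v (root t))"
      by (simp add: ht_comb)
    moreover have "x > 0 \<or> y > 0" using xy by auto
    ultimately show ?thesis using IH[of s] IH[of t] xy
      by (auto intro: add_pos_nonneg add_nonneg_pos)
  qed
qed

end

section \<open>The roots of a word\<close>

text \<open>Linear independence of two vectors.\<close>

definition indep :: "('b \<Rightarrow> int) \<Rightarrow> ('b \<Rightarrow> int) \<Rightarrow> bool" where
  "indep v v' \<longleftrightarrow> (\<forall>x y. (\<forall>i. x * v i = y * v' i) \<longrightarrow> x = 0 \<and> y = 0)"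

context root_action
begin

text \<open>The vectors \<open>s\<^sub>1 \<dots> s\<^sub>j\<^sub>-\<^sub>1 \<cdot> root s\<^sub>j\<close>, which belong to the reflections of the word.\<close>

primrec roots :: "'s list \<Rightarrow> ('b \<Rightarrow> int) list" where
  "roots [] = []"
| "roots (s # e) = root s # map (rf s) (roots e)"

lemma roots_append: "roots (e @ e') = roots e @ map (act e) (roots e')"
proof (induction e)
  case Nil
  then show ?case by (simp add: map_idI)
qed (simp add: comp_def)

lemma indep_rf:
  assumes "s \<in> gens A" "indep v v'"
  shows "indep (rf s v) (rf s v')"
  unfolding indep_def
proof (intro allI impI)
  fix x y assume "\<forall>i. x * rf s v i = y * rf s v' i"
  then have "(\<lambda>i. x * rf s v i + 0 * v i) = (\<lambda>i. y * rf s v' i + 0 * v i)" by auto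
  then have "rf s (\<lambda>i. x * rf s v i + 0 * v i) = rf s (\<lambda>i. y * rf s v' i + 0 * v i)"
    by (rule arg_cong)
  then have "\<forall>i. x * v i = y * v' i"
    unfolding rf_comb by (simp add: rf_rf assms) metis
  then show "x = 0 \<and> y = 0" using assms by (auto simp: indep_def)
qed

lemma mem_roots_iff:
  "v \<in> set (roots e) \<longleftrightarrow> (\<exists>p s q. e = p @ s # q \<and> v = act p (root s))"
proof (induction e arbitrary: v)
  case (Cons a e)
  show ?case
  proof
    assume "v \<in> set (roots (a # e))"
    then consider "v = root a" | p s q where "e = p @ s # q" "v = rf a (act p (root s))"
      using Cons.IH by auto
    then show "\<exists>p s q. a # e = p @ s # q \<and> v = act p (root s)"
    proof cases
      case 1
      then show ?thesis by (intro exI[of _ "[]"]) auto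
    next
      case (2 p s q)
      then show ?thesis by (intro exI[of _ "a # p"] exI[of _ s] exI[of _ q]) auto
    qed
  next
    assume "\<exists>p s q. a # e = p @ s # q \<and> v = act p (root s)"
    then obtain p s q where "a # e = p @ s # q" "v = act p (root s)" by blast
    then show "v \<in> set (roots (a # e))" using Cons.IH by (cases p) auto
  qed
qed auto

text \<open>
  The group element \<open>h\<close> acts as a reflection in the direction of \<open>v\<close>. This determines \<open>v\<close> up to
  proportionality, so elements with independent directions differ.
\<close>

definition acts_as_reflection :: "'s list set \<Rightarrow> ('b \<Rightarrow> int) \<Rightarrow> bool" where
  "acts_as_reflection h v \<longleftrightarrow> (\<exists>e\<in>lists (gens A). h = word_val A e \<and>
    (\<exists>f. \<forall>v'. act e v' = (\<lambda>i. v' i - f v' * v i)) \<and> act e v = (\<lambda>i. - v i))"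

lemma acts_as_reflection_conj:
  assumes s: "s \<in> gens A" and h: "acts_as_reflection h v"
  shows "acts_as_reflection (cox_gen A s \<otimes>\<^bsub>G\<^esub> h \<otimes>\<^bsub>G\<^esub> inv\<^bsub>G\<^esub> cox_gen A s) (rf s v)"
proof -
  obtain e f where e: "e \<in> lists (gens A)" "h = word_val A e"
    "\<And>v'. act e v' = (\<lambda>i. v' i - f v' * v i)" "act e v = (\<lambda>i. - v i)"
    using h unfolding acts_as_reflection_def by blast
  let ?e = "[s] @ e @ [s]"
  have "rf s (act e (rf s v')) = (\<lambda>i. v' i - f (rf s v') * rf s v i)" for v'
    using rf_comb[of s 1 "rf s v'" "- f (rf s v')" v] by (simp add: e(3) rf_rf s)
  moreover have "rf s (act e (rf s (rf s v))) = (\<lambda>i. - rf s v i)"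
    using rf_comb[of s "-1" v 0 v] by (simp add: e(4) rf_rf s)
  moreover have "cox_gen A s \<otimes>\<^bsub>G\<^esub> h \<otimes>\<^bsub>G\<^esub> inv\<^bsub>G\<^esub> cox_gen A s = word_val A ?e"
    unfolding e(2) by (rule conj_word_val[OF s e(1)])
  moreover have "?e \<in> lists (gens A)" using e s by auto
  ultimately show ?thesis unfolding acts_as_reflection_def
    by (intro bexI[of _ ?e]) (auto intro: exI[of _ "\<lambda>v'. f (rf s v')"])
qed

lemma reflections_act:
  "e \<in> lists (gens A) \<Longrightarrow> list_all2 acts_as_reflection (reflections e) (roots e)"
proof (induction e)
  case (Cons s e)
  have "acts_as_reflection (cox_gen A s) (root s)"
    unfolding acts_as_reflection_def using Cons.prems
    by (intro bexI[of _ "[s]"] conjI exI[of _ "ck s"])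
      (auto simp: word_val_eq_cox_class cox_gen_def rf_root, simp add: rf_def)
  then show ?case using Cons
    by (auto simp: list_all2_map1 list_all2_map2 intro: acts_as_reflection_conj
        elim!: list_all2_mono)
qed simp

lemma distinct_if_indep:
  "list_all2 acts_as_reflection hs vs \<Longrightarrow> sorted_wrt indep vs \<Longrightarrow> distinct hs"
proof (induction rule: list_all2_induct)
  case (Cons h hs v vs)
  have "h \<notin> set hs"
  proof
    assume "h \<in> set hs"
    then obtain v' where v': "v' \<in> set vs" "acts_as_reflection h v'"
      using Cons.hyps(2) by (metis in_set_conv_nth list_all2_conv_all_nth)
    obtain e e' f where e: "e \<in> lists (gens A)" "h = word_val A e" "act e v = (\<lambda>i. - v i)"
      and e': "e' \<in> lists (gens A)" "h = word_val A e'" "act e' v = (\<lambda>i. v i - f v * v' i)"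
      using v'(2) Cons.hyps(1) unfolding acts_as_reflection_def by metis
    have "act e v = act e' v" using word_val_eq_iff e e' by (intro act_cox_eq) metis
    then have "\<forall>i. - v i = v i - f v * v' i" using e e' by metis
    then have "\<forall>i. 2 * v i = f v * v' i" by (smt (verit))
    moreover have "indep v v'" using Cons.prems v' by simp
    ultimately show False unfolding indep_def by (metis zero_neq_numeral)
  qed
  then show ?case using Cons by simp
qed simp

corollary distinct_reflections:
  "e \<in> lists (gens A) \<Longrightarrow> sorted_wrt indep (roots e) \<Longrightarrow> distinct (reflections e)"
  by (rule distinct_if_indep[OF reflections_act])

end

context positive_root_action
begin

lemma ht_roots_pos: "red e \<Longrightarrow> v \<in> set (roots e) \<Longrightarrow> ht v > 0"
  unfolding mem_roots_iff using red_append(1) ht_act_root_pos by force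

text \<open>
  A relation \<open>x \<cdot> root s = y \<cdot> s v\<close> implies \<open>- x \<cdot> root s = y \<cdot> v\<close>. If \<open>s\<close> precedes a
  reduced word having \<open>v\<close> among its roots and the longer word is reduced too, then \<open>v\<close> and \<open>s v\<close>
  are both positive, which forces \<open>x = y = 0\<close>.
\<close>

theorem indep_roots: "red e \<Longrightarrow> sorted_wrt indep (roots e)"
proof (induction e)
  case (Cons s e)
  have s: "s \<in> gens A" using red_lists[OF Cons.prems] by auto
  have e: "red e" using red_append(2)[of "[s]" e] Cons.prems by simp
  have "indep (root s) (rf s v)" if v: "v \<in> set (roots e)" for v
    unfolding indep_def
  proof (intro allI impI)
    fix x y assume eq: "\<forall>i. x * root s i = y * rf s v i"
    have ht: "ht v > 0" "ht (rf s v) > 0"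
      using ht_roots_pos[OF e v] ht_roots_pos[OF Cons.prems, of "rf s v"] v by auto
    have "(\<lambda>i. x * root s i + 0 * v i) = (\<lambda>i. y * rf s v i + 0 * v i)" using eq by auto
    then have "ht (\<lambda>i. x * root s i + 0 * v i) = ht (\<lambda>i. y * rf s v i + 0 * v i)"
      "rf s (\<lambda>i. x * root s i + 0 * v i) = rf s (\<lambda>i. y * rf s v i + 0 * v i)" by simp_all
    then have 1: "x * ht (root s) = y * ht (rf s v)"
      and 2: "(\<lambda>i. - x * root s i + 0 * v i) = (\<lambda>i. y * v i + 0 * v i)"
      unfolding rf_comb ht_comb by (simp_all add: rf_root rf_rf s)
    from 2 have "- x * ht (root s) = y * ht v" using ht_comb by (metis add.right_neutral mult_zero_left)
    with 1 have "y * (ht (rf s v) + ht v) = 0" by (simp add: distrib_left)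
    then have "y = 0" using ht by auto
    then show "x = 0 \<and> y = 0" using 1 ht_root[OF s] by auto
  qed
  then show ?case using Cons.IH[OF e] s
    by (auto simp: sorted_wrt_map intro: indep_rf elim!: sorted_wrt_mono_rel[rotated])
qed simp

end

section \<open>Counting a letter\<close>

context coxeter
begin

text \<open>
  The letter \<open>t\<close> occurs an odd number of times in some word for \<open>h\<close>; equivalently in every word,
  when the order of \<open>s t\<close> is even for all other generators \<open>s\<close>.
\<close>

definition odd_in :: "'s \<Rightarrow> 's list set \<Rightarrow> bool" where
  "odd_in t h \<longleftrightarrow> (\<exists>e\<in>lists (gens A). h = word_val A e \<and> odd (count_list e t))"

lemma even_count_list_cong:
  assumes t: "\<And>s. s \<in> gens A \<Longrightarrow> s \<noteq> t \<Longrightarrow> even (cmat A s t) \<and> even (cmat A t s)"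
    and "cox_eq A e e'"
  shows "even (count_list e t) \<longleftrightarrow> even (count_list e' t)"
  using assms(2)
proof (induction rule: cox_eq.induct)
  case (relator a b u v)
  have "count_list (concat (replicate k [a, b])) t = k * count_list [a, b] t" for k
    by (induction k) auto
  moreover have "even (cmat A a b * count_list [a, b] t)"
    using t[of a] t[of b] relator by auto
  ultimately show ?case by simp
qed auto

context
  fixes t
  assumes even_cmat: "\<And>s. s \<in> gens A \<Longrightarrow> s \<noteq> t \<Longrightarrow> even (cmat A s t) \<and> even (cmat A t s)"
begin

lemma odd_in_word_val: "e \<in> lists (gens A) \<Longrightarrow> odd_in t (word_val A e) \<longleftrightarrow> odd (count_list e t)"
  unfolding odd_in_def using even_count_list_cong[OF even_cmat] word_val_eq_iff by blast

lemma odd_in_conj: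
  assumes s: "s \<in> gens A" and h: "h \<in> carrier G"
  shows "odd_in t (cox_gen A s \<otimes>\<^bsub>G\<^esub> h \<otimes>\<^bsub>G\<^esub> inv\<^bsub>G\<^esub> cox_gen A s) \<longleftrightarrow> odd_in t h"
proof -
  obtain e where e: "e \<in> lists (gens A)" "h = word_val A e" using h by (auto simp: carrier_cox_group)
  have l: "[s] @ e @ [s] \<in> lists (gens A)" using e s by auto
  show ?thesis
    unfolding e(2) conj_word_val[OF s e(1)] odd_in_word_val[OF e(1)] odd_in_word_val[OF l] by simp
qed

text \<open>
  Conjugation does not affect parities, so the reflections coming from the letter \<open>t\<close> are exactly
  those in which \<open>t\<close> has odd parity.
\<close>

lemma length_filter_odd_in:
  "e \<in> lists (gens A) \<Longrightarrow> length (filter (odd_in t) (reflections e)) = count_list e t"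
proof (induction e)
  case (Cons s e)
  have s: "s \<in> gens A" and e: "e \<in> lists (gens A)" using Cons.prems by auto
  have "filter (\<lambda>h. odd_in t (cox_gen A s \<otimes>\<^bsub>G\<^esub> h \<otimes>\<^bsub>G\<^esub> inv\<^bsub>G\<^esub> cox_gen A s)) (reflections e)
      = filter (odd_in t) (reflections e)"
    using G.refl_list_closed[OF gens_closed[OF e]] s by (intro filter_cong) (auto simp: odd_in_conj)
  moreover have "odd_in t (cox_gen A s) \<longleftrightarrow> s = t"
    using odd_in_word_val[of "[s]"] s by (simp add: word_val_eq_cox_class cox_gen_def)
  ultimately show ?case
    using Cons.IH[OF e] by (cases "s = t") (simp_all add: filter_map comp_def)
qed simp

end

end

context positive_root_action
begin

lemma distinct_reflections_if_red: "red e \<Longrightarrow> distinct (reflections e)"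
  by (intro distinct_reflections indep_roots red_lists)

text \<open>Two reduced words of one element have the same reflections, hence equally many letters \<open>t\<close>.\<close>

lemma letter_length_eq:
  assumes t: "\<And>s. s \<in> gens A \<Longrightarrow> s \<noteq> t \<Longrightarrow> even (cmat A s t) \<and> even (cmat A t s)"
    and e: "reduced_expr A e w"
  shows "letter_length A t w = count_list e t"
proof -
  define e' where "e' = (SOME e. reduced_expr A e w)"
  have "reduced_expr A e' w" unfolding e'_def using e by (rule someI)
  then have r: "red e" "red e'" "word_val A e = word_val A e'" using e by (auto simp: reduced_expr_iff)
  then have "cox_eq A e e'" using word_val_eq_iff red_lists by blast
  then have "mset (reflections e) = mset (reflections e')"
    by (intro mset_reflections_eq distinct_reflections_if_red r)
  then have "length (filter (odd_in t) (reflections e)) = length (filter (odd_in t) (reflections e'))"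
    by (metis mset_filter size_mset)
  then show ?thesis
    using length_filter_odd_in[OF t red_lists] r by (simp add: letter_length_def e'_def)
qed

end

section \<open>The affine root actions\<close>

text \<open>
  A vector \<open>v\<close> stands for the affine function \<open>v\<^sub>0 / 2 + v\<^sub>1 x\<^sub>1 + v\<^sub>2 x\<^sub>2 + \<dots>\<close>. The simple roots are
  \<open>x\<^sub>1\<close> for \<open>\<sigma>\<^sub>0\<close>, \<open>x\<^sub>i\<^sub>+\<^sub>1 - x\<^sub>i\<close> for \<open>\<sigma>\<^sub>i\<close>, \<open>x\<^sub>1 + x\<^sub>2\<close> for \<open>SigBar\<close>, and \<open>1/2 - x\<^sub>m\<close> for \<open>t\<^sub>m\<close>. They
  do not depend on the group, so that the groups of all ranks and of both types act on one space.
  As the index 0 belongs to the constant term, \<open>\<sigma>\<^sub>0\<close> is an exception among the \<open>\<sigma>\<^sub>i\<close>.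
\<close>

fun aff_root :: "gen \<Rightarrow> nat \<Rightarrow> int" where
  "aff_root (Sig i) = (\<lambda>j. if j = i + 1 then 1 else if j = i \<and> i \<noteq> 0 then - 1 else 0)"
| "aff_root SigBar = (\<lambda>j. if j = 1 \<or> j = 2 then 1 else 0)"
| "aff_root (T m) = (\<lambda>j. if j = 0 then 1 else if j = m then - 1 else 0)"

text \<open>The coroots, as linear forms.\<close>

fun aff_ck :: "gen \<Rightarrow> (nat \<Rightarrow> int) \<Rightarrow> int" where
  "aff_ck (Sig i) v = (if i = 0 then 2 * v 1 else v (i + 1) - v i)"
| "aff_ck SigBar v = v 1 + v 2"
| "aff_ck (T m) v = - 2 * v m"

text \<open>Up to scaling, the value at the point \<open>x\<^sub>i = i / (2 m + 2)\<close> of the fundamental alcove.\<close>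

definition aff_ht :: "nat \<Rightarrow> (nat \<Rightarrow> int) \<Rightarrow> int" where
  "aff_ht m v = (int m + 1) * v 0 + (\<Sum>i = 1..m. int i * v i)"

lemma aff_ck_diff: "aff_ck s (\<lambda>i. v i - c * v' i) = aff_ck s v - c * aff_ck s v'"
  by (cases s) (simp_all add: algebra_simps)

lemma aff_ht_comb: "aff_ht m (\<lambda>i. x * v i + y * v' i) = x * aff_ht m v + y * aff_ht m v'"
  by (simp add: aff_ht_def sum.distrib sum_distrib_left algebra_simps)

lemma aff_ht_root:
  assumes "m \<ge> 2" "s \<in> Sig ` {0..<m} \<union> {SigBar, T m}"
  shows "aff_ht m (aff_root s) > 0"
proof -
  have *: "(\<Sum>i = 1..m. int i * (if i = k then c else 0)) = (if k \<in> {1..m} then int k * c else 0)" for k c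
    by (simp add: if_distrib[of "(*) _"] cong: if_cong)
  have sum: "(\<Sum>i = 1..m. int i * v i) = (\<Sum>i = 1..m. int i * v' i)"
    if "\<And>i. i \<ge> 1 \<Longrightarrow> v i = v' i" for v v'
    by (intro sum.cong) (use that in auto)
  show ?thesis
  proof (cases s)
    case (Sig k)
    then have k: "k < m" using assms by auto
    have "(\<Sum>i = 1..m. int i * aff_root s i)
        = (\<Sum>i = 1..m. int i * ((if i = k + 1 then 1 else 0) + (if i = k then - 1 else 0)))"
      by (rule sum) (simp add: Sig)
    also have "\<dots> = int (k + 1) - (if k = 0 then 0 else int k)"
      unfolding distrib_left sum.distrib * using k by auto
    finally show ?thesis using Sig by (simp add: aff_ht_def)
  next
    case SigBar
    have "(\<Sum>i = 1..m. int i * aff_root s i)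
        = (\<Sum>i = 1..m. int i * ((if i = 1 then 1 else 0) + (if i = 2 then 1 else 0)))"
      by (rule sum) (simp add: SigBar)
    also have "\<dots> = 3"
      unfolding distrib_left sum.distrib * using assms by auto
    finally show ?thesis using SigBar by (simp add: aff_ht_def)
  next
    case (T k)
    then have k: "k = m" using assms by auto
    have "(\<Sum>i = 1..m. int i * aff_root s i) = (\<Sum>i = 1..m. int i * (if i = m then - 1 else 0))"
      by (rule sum) (simp add: T k)
    also have "\<dots> = - int m" unfolding * using assms by auto
    finally show ?thesis using T by (simp add: aff_ht_def)
  qed
qed

lemma positive_root_action_C:
  assumes "m \<ge> 2"
  shows "positive_root_action (C_tilde m) aff_root aff_ck (aff_ht m)"
proof
  fix s t assume s: "s \<in> gens (C_tilde m)"
  then show "aff_ck s (aff_root s) = 2" using assms by (auto simp: C_tilde_def)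
  show "aff_ht m (aff_root s) > 0" using s assms by (intro aff_ht_root) (auto simp: C_tilde_def)
  assume t: "t \<in> gens (C_tilde m)" and st: "s \<noteq> t"
  show "cmat (C_tilde m) t s = cmat (C_tilde m) s t \<and>
      (cmat (C_tilde m) s t, aff_ck s (aff_root t), aff_ck t (aff_root s))
        \<in> {(2, 0, 0), (3, -1, -1), (4, -1, -2), (4, -2, -1)}"
    using s t st assms by (cases s; cases t) (auto simp: C_tilde_def doubleton_eq_iff)
qed (simp_all add: aff_ck_diff aff_ht_comb)

lemma positive_root_action_B:
  assumes "m \<ge> 3"
  shows "positive_root_action (B_tilde m) aff_root aff_ck (aff_ht m)"
proof
  fix s t assume s: "s \<in> gens (B_tilde m)"
  then show "aff_ck s (aff_root s) = 2" using assms by (auto simp: B_tilde_def)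
  show "aff_ht m (aff_root s) > 0" using s assms by (intro aff_ht_root) (auto simp: B_tilde_def)
  assume t: "t \<in> gens (B_tilde m)" and st: "s \<noteq> t"
  show "cmat (B_tilde m) t s = cmat (B_tilde m) s t \<and>
      (cmat (B_tilde m) s t, aff_ck s (aff_root t), aff_ck t (aff_root s))
        \<in> {(2, 0, 0), (3, -1, -1), (4, -1, -2), (4, -2, -1)}"
    using s t st assms by (cases s; cases t) (auto simp: B_tilde_def doubleton_eq_iff)
qed (simp_all add: aff_ck_diff aff_ht_comb)

section \<open>Substituting in reduced words\<close>

lemma subst_word_simps [simp]:
  "subst_word n [] = []" "subst_word n (s # e) = subst_letter n s @ subst_word n e"
  "subst_word n (e @ e') = subst_word n e @ subst_word n e'"
  by (simp_all add: subst_word_def)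

lemma subst_word_ident: "T n \<notin> set e \<Longrightarrow> subst_word n e = e"
  by (induction e) (auto simp: subst_letter_def)

lemma length_subst_word: "length (subst_word n e) = length e + 2 * count_list e (T n)"
  by (induction e) (auto simp: subst_letter_def)

lemma subst_word_interleave:
  assumes "\<And>i. i \<le> s \<Longrightarrow> T n \<notin> set (u i)"
  shows "subst_word n (interleave [T n] u s) = interleave [Sig n, T (n + 1), Sig n] u s"
proof -
  have "subst_word n (concat (map (\<lambda>i. [T n] @ u (i + 1)) [0..<k]))
      = concat (map (\<lambda>i. [Sig n, T (n + 1), Sig n] @ u (i + 1)) [0..<k])" if "k \<le> s" for k
    using that by (induction k) (auto simp: assms subst_word_ident subst_letter_def)
  then show ?thesis using assms[of 0] by (simp add: interleave_def subst_word_ident)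
qed

text \<open>
  What the two towers have in common. The action of the smaller group is positive; that of the
  larger one serves only to tell its elements apart.
\<close>

locale tower =
  A: positive_root_action A aff_root aff_ck ht + A': root_action A' aff_root aff_ck
  for A A' :: "gen coxeter_datum" and ht :: "(nat \<Rightarrow> int) \<Rightarrow> int" +
  fixes n :: nat and I :: "gen list set \<Rightarrow> gen list set"
  assumes n: "n \<ge> 2"
    and gens: "gens A \<subseteq> Sig ` {0..<n} \<union> {SigBar, T n}"
    and gens': "gens A - {T n} \<union> {Sig n, T (n + 1)} \<subseteq> gens A'"
    and T_gen: "T n \<in> gens A"
    and even_T: "s \<in> gens A \<Longrightarrow> s \<noteq> T n \<Longrightarrow> even (cmat A s (T n)) \<and> even (cmat A (T n) s)"
    and hom: "is_tower_hom n A A' I"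
begin

lemma subst_letter_lists: "s \<in> gens A \<Longrightarrow> subst_letter n s \<in> lists (gens A')"
  using gens' by (auto simp: subst_letter_def)

lemma subst_word_lists: "e \<in> lists (gens A) \<Longrightarrow> subst_word n e \<in> lists (gens A')"
proof (induction e)
  case (Cons s e)
  then show ?case using subst_letter_lists[of s] by auto
qed simp

lemma word_val_subst_word: "e \<in> lists (gens A) \<Longrightarrow> word_val A' (subst_word n e) = I (word_val A e)"
proof (induction e)
  case Nil
  have "I \<one>\<^bsub>A.G\<^esub> = \<one>\<^bsub>A'.G\<^esub>"
    using hom A.G.is_group A'.G.is_group by (intro hom_one) (auto simp: is_tower_hom_def)
  then show ?case by (simp add: word_val_def list_prod_def)
next
  case (Cons s e)
  have s: "s \<in> gens A" and e: "e \<in> lists (gens A)" using Cons.prems by auto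
  have "word_val A (s # e) = cox_gen A s \<otimes>\<^bsub>A.G\<^esub> word_val A e"
    by (simp add: word_val_def list_prod_def)
  then have "I (word_val A (s # e)) = I (cox_gen A s) \<otimes>\<^bsub>A'.G\<^esub> I (word_val A e)"
    using hom hom_mult[of I A.G A'.G] cox_gen_closed[OF s] A.word_val_closed[OF e]
    by (auto simp: is_tower_hom_def)
  moreover have "I (cox_gen A s) = word_val A' (subst_letter n s)"
    using hom s gens' cox_gen_closed[of _ A']
    by (auto simp: is_tower_hom_def subst_letter_def word_val_def list_prod_def A'.G.m_assoc)
  ultimately show ?case
    using Cons.IH[OF e] A'.word_val_append[OF subst_letter_lists[OF s] subst_word_lists[OF e]] by simp
qed

text \<open>
  The root \<open>1/2 - x\<^sub>n\<^sub>+\<^sub>1\<close>. It is fixed by the smaller group, whose roots do not involve \<open>x\<^sub>n\<^sub>+\<^sub>1\<close>.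
\<close>

abbreviation \<tau> where "\<tau> \<equiv> aff_root (T (n + 1))"

text \<open>Both \<open>t\<^sub>n\<close> and \<open>\<sigma>\<^sub>n t\<^sub>n\<^sub>+\<^sub>1 \<sigma>\<^sub>n\<close> act as \<open>x\<^sub>n \<mapsto> 1 - x\<^sub>n\<close>.\<close>

lemma rf_subst_letter: "s \<in> gens A \<Longrightarrow> A.act (subst_letter n s) v = A.rf s v"
  using n by (auto simp: subst_letter_def A.rf_def fun_eq_iff)

lemma rf_shift:
  assumes "s \<in> gens A"
  shows "A.rf s (\<lambda>i. v i + c * \<tau> i) = (\<lambda>i. A.rf s v i + c * \<tau> i)"
proof -
  have "aff_ck s \<tau> = 0" using assms gens n by auto
  then have "A.rf s \<tau> = \<tau>" by (simp add: A.rf_def)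
  then show ?thesis using A.rf_comb[of s 1 v c \<tau>] by simp
qed

lemma roots_subst_letter:
  "A.roots (subst_letter n s) = (if s = T n
    then map (\<lambda>c i. aff_root (T n) i + c * \<tau> i) [- 1, 0, 1] else [aff_root s])"
  using n by (auto simp: subst_letter_def A.rf_def fun_eq_iff)

lemma aff_root_last: "s \<in> gens A \<Longrightarrow> aff_root s (n + 1) = 0"
  using gens n by auto

lemma roots_last: "e \<in> lists (gens A) \<Longrightarrow> v \<in> set (A.roots e) \<Longrightarrow> v (n + 1) = 0"
proof (induction e arbitrary: v)
  case (Cons s e)
  then show ?case using aff_root_last[of s] by (auto simp: A.rf_def)
qed simp

lemma indep_shift:
  assumes "v (n + 1) = 0" "v' (n + 1) = 0" "indep v v'"
  shows "indep (\<lambda>i. v i + c * \<tau> i) (\<lambda>i. v' i + c' * \<tau> i)"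
  unfolding indep_def
proof (intro allI impI)
  fix x y assume eq: "\<forall>i. x * (v i + c * \<tau> i) = y * (v' i + c' * \<tau> i)"
  from eq[rule_format, of "n + 1"] have c: "x * c = y * c'" using assms by simp
  have "x * v i = y * v' i" for i
  proof -
    have "x * v i + (x * c) * \<tau> i = y * v' i + (y * c') * \<tau> i"
      using eq[rule_format, of i] by (simp add: algebra_simps)
    then show ?thesis unfolding c by simp
  qed
  then show "x = 0 \<and> y = 0" using assms(3) unfolding indep_def by blast
qed

lemma indep_block:
  assumes "c \<noteq> c'"
  shows "indep (\<lambda>i. aff_root (T n) i + c * \<tau> i) (\<lambda>i. aff_root (T n) i + c' * \<tau> i)"
  unfolding indep_def
proof (intro allI impI)
  fix x y assume eq: "\<forall>i. x * (aff_root (T n) i + c * \<tau> i) = y * (aff_root (T n) i + c' * \<tau> i)"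
  from eq[rule_format, of n] have "x = y" using n by simp
  moreover from eq[rule_format, of "n + 1"] have "x * c = y * c'" using n by simp
  ultimately show "x = 0 \<and> y = 0" using assms by auto
qed

text \<open>Modulo \<open>\<tau>\<close>, the substituted word has no roots other than those of \<open>e\<close>.\<close>

lemma roots_subst_word:
  "e \<in> lists (gens A) \<Longrightarrow> v \<in> set (A.roots (subst_word n e)) \<Longrightarrow>
    \<exists>v'\<in>set (A.roots e). \<exists>c. v = (\<lambda>i. v' i + c * \<tau> i)"
proof (induction e arbitrary: v)
  case (Cons s e)
  have s: "s \<in> gens A" and e: "e \<in> lists (gens A)" using Cons.prems by auto
  from Cons.prems(2) consider "v \<in> set (A.roots (subst_letter n s))"
    | v1 where "v1 \<in> set (A.roots (subst_word n e))" "v = A.rf s v1"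
    by (auto simp: A.roots_append rf_subst_letter[OF s])
  then show ?case
  proof cases
    case 1
    have "\<exists>c. v = (\<lambda>i. aff_root s i + c * \<tau> i)"
    proof (cases "s = T n")
      case True
      then have "v \<in> (\<lambda>c i. aff_root s i + c * \<tau> i) ` {- 1, 0, 1}"
        using 1 unfolding roots_subst_letter
        by (simp only: simp_thms if_True set_map list.set)
      then show ?thesis by blast
    next
      case False
      then have "v = aff_root s" using 1 unfolding roots_subst_letter by simp
      then show ?thesis by (intro exI[of _ 0]) simp
    qed
    then show ?thesis by auto
  next
    case 2
    then obtain v' c where "v' \<in> set (A.roots e)" "v1 = (\<lambda>i. v' i + c * \<tau> i)"
      using Cons.IH[OF e] by blast
    then show ?thesis using 2 rf_shift[OF s] by auto
  qed
qed simp

text \<open>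
  Roots that come from different letters of \<open>e\<close> are independent modulo \<open>\<tau>\<close>; those that come from
  one letter \<open>t\<^sub>n\<close> have the same image modulo \<open>\<tau>\<close> but different multiples of \<open>\<tau>\<close>.
\<close>

lemma indep_roots_subst_word: "A.red e \<Longrightarrow> sorted_wrt indep (A.roots (subst_word n e))"
proof (induction e)
  case (Cons s e)
  have s: "s \<in> gens A" and e: "e \<in> lists (gens A)" using A.red_lists[OF Cons.prems] by auto
  have r: "A.red e" using A.red_append(2)[of "[s]" e] Cons.prems by simp
  have block: "sorted_wrt indep (A.roots (subst_letter n s))"
    unfolding roots_subst_letter
    using indep_block[of "- 1" 0] indep_block[of "- 1" 1] indep_block[of 0 1]
    by (simp del: aff_root.simps)
  have tail: "sorted_wrt indep (map (A.rf s) (A.roots (subst_word n e)))"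
    using Cons.IH[OF r] s
    by (auto simp: sorted_wrt_map intro: A.indep_rf elim!: sorted_wrt_mono_rel[rotated])
  have "indep v (A.rf s v')"
    if v: "v \<in> set (A.roots (subst_letter n s))" and v': "v' \<in> set (A.roots (subst_word n e))"
    for v v'
  proof -
    obtain c where c: "v = (\<lambda>i. aff_root s i + c * \<tau> i)"
      using v roots_subst_word[of "[s]" v] s by auto
    obtain v1 c1 where v1: "v1 \<in> set (A.roots e)" and c1: "v' = (\<lambda>i. v1 i + c1 * \<tau> i)"
      using roots_subst_word[OF e v'] by blast
    have "indep (aff_root s) (A.rf s v1)" using A.indep_roots[OF Cons.prems] v1 by auto
    moreover have "A.rf s v1 (n + 1) = 0"
      using roots_last[OF A.red_lists[OF Cons.prems], of "A.rf s v1"] v1 by simp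
    ultimately show ?thesis
      unfolding c c1 rf_shift[OF s] using aff_root_last[OF s] by (intro indep_shift)
  qed
  moreover have "A.act (subst_letter n s) = A.rf s" using rf_subst_letter[OF s] by blast
  ultimately show ?case using block tail by (auto simp: A.roots_append sorted_wrt_append)
qed simp

lemma distinct_reflections_subst_word:
  "A.red e \<Longrightarrow> distinct (A'.reflections (subst_word n e))"
  by (intro A'.distinct_reflections indep_roots_subst_word subst_word_lists A.red_lists)

lemma reduced_expr_subst_word:
  "reduced_expr A e w \<Longrightarrow> reduced_expr A' (subst_word n e) (I w)"
  unfolding A.reduced_expr_iff A'.reduced_expr_iff
  using A'.red_if_distinct_reflections distinct_reflections_subst_word subst_word_lists
    word_val_subst_word A.red_lists by blast

theorem word_Phi_subst_word:
  assumes "reduced_expr A e w"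
  shows "size (word_Phi A' (subst_word n e)) = cox_length A w + 2 * letter_length A (T n) w"
    and "card (set_mset (word_Phi A' (subst_word n e))) = size (word_Phi A' (subst_word n e))"
proof -
  have r: "A.red e" using assms by (simp add: A.reduced_expr_iff)
  have P: "word_Phi A' (subst_word n e) = mset (A'.reflections (subst_word n e))"
    using A.red_lists[OF r] by (intro A'.word_Phi_eq subst_word_lists)
  show "size (word_Phi A' (subst_word n e)) = cox_length A w + 2 * letter_length A (T n) w"
    using assms A.letter_length_eq[OF even_T assms]
    by (simp add: P length_subst_word reduced_expr_def)
  show "card (set_mset (word_Phi A' (subst_word n e))) = size (word_Phi A' (subst_word n e))"
    using distinct_card[OF distinct_reflections_subst_word[OF r]] by (simp add: P)
qed

end

lemma tower_F_hom:
  assumes "n \<ge> 2"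
  shows "tower (C_tilde n) (C_tilde (n + 1)) (aff_ht n) n (F_hom n)"
proof -
  interpret C: positive_root_action "C_tilde n" aff_root aff_ck "aff_ht n"
    by (rule positive_root_action_C) (rule assms)
  interpret C': positive_root_action "C_tilde (n + 1)" aff_root aff_ck "aff_ht (n + 1)"
    by (rule positive_root_action_C) (use assms in simp)
  show ?thesis
    by unfold_locales (use assms is_tower_hom_F_hom[of n] in \<open>auto simp: C_tilde_def doubleton_eq_iff\<close>)
qed

lemma tower_L_hom:
  assumes "n \<ge> 3"
  shows "tower (B_tilde n) (B_tilde (n + 1)) (aff_ht n) n (L_hom n)"
proof -
  interpret B: positive_root_action "B_tilde n" aff_root aff_ck "aff_ht n"
    by (rule positive_root_action_B) (rule assms)
  interpret B': positive_root_action "B_tilde (n + 1)" aff_root aff_ck "aff_ht (n + 1)"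
    by (rule positive_root_action_B) (use assms in simp)
  show ?thesis
    by unfold_locales (use assms is_tower_hom_L_hom[of n] in \<open>auto simp: B_tilde_def doubleton_eq_iff\<close>)
qed

theorem theorem2p6:
  fixes n s :: nat
    and A A' :: "gen coxeter_datum"
    and I :: "gen list set \<Rightarrow> gen list set"
    and w :: "gen list set"
    and u :: "nat \<Rightarrow> gen list"
  assumes tower:
      "(n \<ge> 2 \<and> A = C_tilde n \<and> A' = C_tilde (n + 1) \<and> I = F_hom n) \<or>
       (n \<ge> 3 \<and> A = B_tilde n \<and> A' = B_tilde (n + 1) \<and> I = L_hom n)"
    and w: "w \<in> carrier (cox_group A)"
    and u: "\<And>i. i \<le> s \<Longrightarrow> u i \<in> lists (gens A - {T n}) \<and> reduced_word A (u i)"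
    and expr: "reduced_expr A (interleave [T n] u s) w"
  shows "word_val A' (interleave [Sig n, T (n + 1), Sig n] u s) = I w \<and>
    size (word_Phi A' (interleave [Sig n, T (n + 1), Sig n] u s))
      = card (set_mset (word_Phi A' (interleave [Sig n, T (n + 1), Sig n] u s))) \<and>
    card (set_mset (word_Phi A' (interleave [Sig n, T (n + 1), Sig n] u s)))
      = cox_length A w + 2 * letter_length A (T n) w \<and>
    (\<forall>e. reduced_expr A e w \<longrightarrow> reduced_expr A' (subst_word n e) (I w))"
proof -
  have "tower A A' (aff_ht n) n I"
    using tower tower_F_hom tower_L_hom by auto
  then interpret tower A A' "aff_ht n" n I .
  have "subst_word n (interleave [T n] u s) = interleave [Sig n, T (n + 1), Sig n] u s"
    using u by (intro subst_word_interleave) auto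
  then show ?thesis
    using word_Phi_subst_word[OF expr] reduced_expr_subst_word reduced_expr_subst_word[OF expr]
    by (simp add: reduced_expr_def)
qed

end
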